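(* For all $v\in\{1,2,\dots,V\}$ we have $\mathfrak{H}_{V,v}=\mathfrak{H}_{V,1}$. Moreover, suppose that $\mathcal{P}^{a}=\dfrac{P_{n_1}P_{n_2}\cdots P_{n_V}}{V^{MV}}$ for every $a\in\mathcal{A}$. Let $K^{(1)}\in\mathbb{H}^V$ be any initial $V$-tuple of non-empty compact subsets of $\mathbb{X}$, and let $K^{(l+1)}=f^{a^{(l)}}(K^{(l)})$ for $l\ge1$, where $a^{(1)},a^{(2)},\dots$ are chosen independently from $\mathcal{A}$ with probabilities $\{\mathcal{P}^a\}_{a\in\mathcal{A}}$. Then, almost surely, for every $v\in\{1,\dots,V\}$ the empirical measures $\frac1n\sum_{l=1}^n\delta_{K^{(l)}_v}$ on $\mathbb{H}$ of the $v$-th components converge weakly, as $n\to\infty$, to the marginal probability measure $$\mathfrak{P}_{V,1}(B):=\mathfrak{P}_V(B\times\mathbb{H}\times\cdots\times\mathbb{H}),\qquad B\subset\mathbb{H}\text{ Borel},$$ independently of $v$.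
   Context: IFS. An IFS (with probabilities) on a compact metric space $Y$ is a finite family of contraction maps $g_a:Y\to Y$ together with probabilities $p_a\ge 0$, $\sum_a p_a=1$. Its set attractor is the unique non-empty compact $A\subset Y$ with $A=\bigcup_a g_a(A)$; its measure attractor is the unique Borel probability measure $\mu$ on $Y$ with $\mu=\sum_a p_a\, g_a(\mu)$, where $g(\mu)=\mu\circ g^{-1}$. SuperIFS. $(\mathbb{X},d)$ is a compact metric space; $M,N,V$ are positive integers. For $n\in\{1,\dots,N\}$, $m\in\{1,\dots,M\}$, $f_m^n:\mathbb{X}\to\mathbb{X}$ is Lipschitz with constant $l$, where $0\le l<1$ is fixed. $P_1,\dots,P_N>0$ with $\sum_nP_n=1$. The IFS $\mathcal{F}_V$. $\mathbb{H}=\mathbb{H}(\mathbb{X})$ is the set of non-empty compact subsets of $\mathbb{X}$ with the Hausdorff metric, and $\mathbb{H}^V$ carries the maximum metric. $\mathcal{A}=\{\{1,\dots,N\}\times\{1,\dots,V\}^M\}^V$; write $a=(a_1,\dots,a_V)\in\mathcal{A}$ with $a_v=(n_v;v_{v,1},\dots,v_{v,M})$. $\{\mathcal{P}^a\}_{a\in\mathcal{A}}$ are probabilities ($\mathcal P^a\ge0$, $\sum_a\mathcal P^a=1$). For $a\in\mathcal{A}$ define $f^a:\mathbb{H}^V\to\mathbb{H}^V$ by letting the $v$-th component of $f^a(K_1,\dots,K_V)$ be $\bigcup_{m=1}^M f_m^{n_v}(K_{v_{v,m}})$. $\mathcal{F}_V=\{\mathbb{H}^V;f^a,\mathcal{P}^a,a\in\mathcal{A}\}$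 is an IFS of contractions; its set attractor is $\mathfrak{H}_V\subset\mathbb{H}^V$ and its measure attractor is $\mathfrak{P}_V$. $\mathfrak{H}_{V,v}\subset\mathbb{H}$ is the set of $v$-th components of elements of $\mathfrak{H}_V$. *)

theory Defs
  imports "HOL-Probability.Probability"
begin

typedef (overloaded) 'x hyperspace = "{K :: 'x::topological_space set. compact K \<and> K \<noteq> {}}"
  morphisms hset Hyp
proof -
  have "compact {undefined :: 'x}" by simp
  then show ?thesis by blast
qed

lemma hset_compact: "compact (hset K)"
  and hset_nonempty: "hset K \<noteq> {}"
  using hset[of K] by auto

lemma hset_Hyp: "compact K \<Longrightarrow> K \<noteq> {} \<Longrightarrow> hset (Hyp K) = K"
  by (simp add: Hyp_inverse)

definition hausdorff_dist :: "'x::metric_space set \<Rightarrow> 'x set \<Rightarrow> real" where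
  "hausdorff_dist A B = max (SUP a\<in>A. infdist a B) (SUP b\<in>B. infdist b A)"

lemma bdd_above_infdist_compact:
  fixes A B :: "'x::metric_space set"
  assumes "compact A"
  shows "bdd_above ((\<lambda>a. infdist a B) ` A)"
proof -
  have "compact ((\<lambda>a. infdist a B) ` A)"
    using assms by (intro compact_continuous_image continuous_intros)
  then show ?thesis by (simp add: compact_imp_bounded bounded_imp_bdd_above)
qed

lemma hausdorff_dist_le_iff:
  fixes A B :: "'x::metric_space set"
  assumes "compact A" "A \<noteq> {}" "compact B" "B \<noteq> {}"
  shows "hausdorff_dist A B \<le> e \<longleftrightarrow> (\<forall>a\<in>A. infdist a B \<le> e) \<and> (\<forall>b\<in>B. infdist b A \<le> e)"
  using assms bdd_above_infdist_compact[of A B] bdd_above_infdist_compact[of B A]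
  by (simp add: hausdorff_dist_def cSUP_le_iff)

instantiation hyperspace :: (metric_space) metric_space
begin

definition dist_hyperspace :: "'a hyperspace \<Rightarrow> 'a hyperspace \<Rightarrow> real" where
  "dist_hyperspace K L = hausdorff_dist (hset K) (hset L)"

definition uniformity_hyperspace :: "('a hyperspace \<times> 'a hyperspace) filter" where
  "uniformity_hyperspace = (INF e\<in>{0<..}. principal {(x, y). dist x y < e})"

definition open_hyperspace :: "'a hyperspace set \<Rightarrow> bool" where
  "open_hyperspace U \<longleftrightarrow> (\<forall>x\<in>U. eventually (\<lambda>(x', y). x' = x \<longrightarrow> y \<in> U) uniformity)"

instance
proof
  have le_iff: "dist K L \<le> e \<longleftrightarrow>
      (\<forall>a\<in>hset K. infdist a (hset L) \<le> e) \<and> (\<forall>b\<in>hset L. infdist b (hset K) \<le> e)"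
    for K L :: "'a hyperspace" and e
    unfolding dist_hyperspace_def
    by (rule hausdorff_dist_le_iff) (simp_all add: hset_compact hset_nonempty)
  have commute: "dist K L = dist L K" for K L :: "'a hyperspace"
    by (simp add: dist_hyperspace_def hausdorff_dist_def max.commute)
  have nonneg: "0 \<le> dist K L" for K L :: "'a hyperspace"
  proof -
    obtain a where "a \<in> hset K" using hset_nonempty by blast
    then have "infdist a (hset L) \<le> dist K L" using le_iff[of K L "dist K L"] by simp
    then show ?thesis using infdist_nonneg[of a "hset L"] by linarith
  qed
  show "dist K L = 0 \<longleftrightarrow> K = L" for K L :: "'a hyperspace"
  proof
    assume "dist K L = 0"
    then have *: "\<forall>a\<in>hset K. infdist a (hset L) \<le> 0" "\<forall>b\<in>hset L. infdist b (hset K) \<le> 0"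
      using le_iff[of K L 0] by simp_all
    have "a \<in> hset M" if "infdist a (hset M) \<le> 0" for a and M :: "'a hyperspace"
      using that infdist_nonneg[of a "hset M"] hset_compact[of M] hset_nonempty[of M]
      by (simp add: in_closed_iff_infdist_zero compact_imp_closed)
    with * have "hset K = hset L" by blast
    then show "K = L" by (simp add: hset_inject)
  next
    assume "K = L"
    then have "dist K L \<le> 0" using le_iff[of K L 0] by simp
    with nonneg[of K L] show "dist K L = 0" by linarith
  qed
  have half: "infdist a (hset L) \<le> dist K M + dist L M" if "a \<in> hset K"
    for a and K L M :: "'a hyperspace"
  proof -
    obtain b where b: "b \<in> hset M" "infdist a (hset M) = dist a b"
    proof -
      obtain b where "b \<in> hset M" and min: "\<forall>c\<in>hset M. dist a b \<le> dist a c"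
        using continuous_attains_inf[OF hset_compact[of M] hset_nonempty[of M],
            OF continuous_on_dist[OF continuous_on_const continuous_on_id]]
        by metis
      moreover have "dist a b \<le> infdist a (hset M)"
        using min by (simp add: infdist_notempty hset_nonempty cINF_greatest)
      ultimately show thesis using that infdist_le[of b "hset M" a] by force
    qed
    have 1: "infdist a (hset M) \<le> dist K M" using le_iff[of K M "dist K M"] that by simp
    have 2: "infdist b (hset L) \<le> dist L M" using le_iff[of L M "dist L M"] b by simp
    show ?thesis using infdist_triangle[of a "hset L" b] 1 2 b(2) by linarith
  qed
  show "dist K L \<le> dist K M + dist L M" for K L M :: "'a hyperspace"
    using half[of _ K L M] half[of _ L K M] by (auto simp: le_iff add.commute)
qed (rule uniformity_hyperspace_def open_hyperspace_def)+

end

text \<open>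
  The existing metrics on \<^typ>\<open>'h ^ 'v\<close> (Euclidean) and on \<^typ>\<open>'v \<Rightarrow> 'h\<close> (a weighted series) are
  not the maximum metric, hence a separate type.
\<close>

typedef ('h, 'v) tuple = "UNIV :: ('v \<Rightarrow> 'h) set"
  morphisms entry Tup ..

lemma entry_Tup [simp]: "entry (Tup x) = x"
  by (simp add: Tup_inverse)

instantiation tuple :: (metric_space, finite) metric_space
begin

definition dist_tuple :: "('a, 'b) tuple \<Rightarrow> ('a, 'b) tuple \<Rightarrow> real" where
  "dist_tuple x y = (MAX v. dist (entry x v) (entry y v))"

definition uniformity_tuple :: "(('a, 'b) tuple \<times> ('a, 'b) tuple) filter" where
  "uniformity_tuple = (INF e\<in>{0<..}. principal {(x, y). dist x y < e})"

definition open_tuple :: "('a, 'b) tuple set \<Rightarrow> bool" where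
  "open_tuple U \<longleftrightarrow> (\<forall>x\<in>U. eventually (\<lambda>(x', y). x' = x \<longrightarrow> y \<in> U) uniformity)"

instance
proof
  have le_iff: "dist x y \<le> e \<longleftrightarrow> (\<forall>v. dist (entry x v) (entry y v) \<le> e)"
    for x y :: "('a, 'b) tuple" and e
    unfolding dist_tuple_def by (subst Max_le_iff) auto
  have entry_le: "dist (entry x v) (entry y v) \<le> dist x y" for x y :: "('a, 'b) tuple" and v
    using le_iff[of x y "dist x y"] by simp
  show "dist x y = 0 \<longleftrightarrow> x = y" for x y :: "('a, 'b) tuple"
  proof
    assume "dist x y = 0"
    then have "entry x v = entry y v" for v using entry_le[of x v y] by simp
    then show "x = y" by (simp add: entry_inject[symmetric] fun_eq_iff)
  qed (simp add: dist_tuple_def)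
  show "dist x y \<le> dist x z + dist y z" for x y z :: "('a, 'b) tuple"
    unfolding le_iff
  proof
    fix v
    show "dist (entry x v) (entry y v) \<le> dist x z + dist y z"
      using dist_triangle2[of "entry x v" "entry y v" "entry z v"] entry_le[of x v z] entry_le[of y v z]
      by linarith
  qed
qed (rule uniformity_tuple_def open_tuple_def)+

end

definition set_attractor :: "('i \<Rightarrow> 'y::topological_space \<Rightarrow> 'y) \<Rightarrow> 'y set" where
  "set_attractor g = (THE A. A \<noteq> {} \<and> compact A \<and> A = (\<Union>i. g i ` A))"

definition measure_attractor ::
    "('i::finite \<Rightarrow> 'y::topological_space \<Rightarrow> 'y) \<Rightarrow> ('i \<Rightarrow> real) \<Rightarrow> 'y measure" where
  "measure_attractor g p = (THE \<mu>. prob_space \<mu> \<and> sets \<mu> = sets borel \<and>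
     (\<forall>B\<in>sets borel. measure \<mu> B = (\<Sum>i\<in>UNIV. p i * measure (distr \<mu> borel (g i)) B)))"

text \<open>
  The finite non-empty types \<open>'n\<close>, \<open>'m\<close>, \<open>'v\<close> play the roles of the index sets \<open>{1..N}\<close>, \<open>{1..M}\<close>,
  \<open>{1..V}\<close>.  An address assigns to every \<open>v\<close> the index \<open>n\<^sub>v\<close> and the row \<open>m \<mapsto> v\<^bsub>v,m\<^esub>\<close>.
\<close>

type_synonym ('n, 'm, 'v) address = "'v \<Rightarrow> 'n \<times> ('m \<Rightarrow> 'v)"

text \<open>
  For continuous \<open>f n m\<close> the union below is compact and non-empty, so \<^const>\<open>Hyp\<close> is applied to a
  set in its domain.
\<close>

definition super_map ::
    "('n \<Rightarrow> 'm::finite \<Rightarrow> 'x::metric_space \<Rightarrow> 'x) \<Rightarrow> ('n, 'm, 'v) address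
      \<Rightarrow> ('x hyperspace, 'v) tuple \<Rightarrow> ('x hyperspace, 'v) tuple" where
  "super_map f a K =
     Tup (\<lambda>v. Hyp (\<Union>m. f (fst (a v)) m ` hset (entry K (snd (a v) m))))"

definition super_set ::
    "('n::finite \<Rightarrow> 'm::finite \<Rightarrow> 'x::metric_space \<Rightarrow> 'x) \<Rightarrow> ('x hyperspace, 'v::finite) tuple set" where
  "super_set f = set_attractor (super_map f)"

definition super_measure ::
    "('n::finite \<Rightarrow> 'm::finite \<Rightarrow> 'x::metric_space \<Rightarrow> 'x) \<Rightarrow> (('n, 'm, 'v::finite) address \<Rightarrow> real)
      \<Rightarrow> ('x hyperspace, 'v) tuple measure" where
  "super_measure f p = measure_attractor (super_map f) p"

definition component_set :: "('h, 'v) tuple set \<Rightarrow> 'v \<Rightarrow> 'h set" where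
  "component_set A v = (\<lambda>K. entry K v) ` A"

definition marginal ::
    "('h::metric_space, 'v::finite) tuple measure \<Rightarrow> 'v \<Rightarrow> 'h measure" where
  "marginal \<mu> v = distr \<mu> borel (\<lambda>K. entry K v)"

definition empirical_measure :: "(nat \<Rightarrow> 'y::topological_space) \<Rightarrow> nat \<Rightarrow> 'y measure" where
  "empirical_measure x n =
     measure_of UNIV (sets borel) (\<lambda>B. (\<Sum>k = 1..n. emeasure (return borel (x k)) B) / of_nat n)"

definition weakly_converges :: "(nat \<Rightarrow> 'y::topological_space measure) \<Rightarrow> 'y measure \<Rightarrow> bool" where
  "weakly_converges \<mu> \<nu> \<longleftrightarrow>
     (\<forall>\<phi> :: 'y \<Rightarrow> real. continuous_on UNIV \<phi> \<and> bounded (range \<phi>) \<longrightarrow>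
        (\<lambda>n. integral\<^sup>L (\<mu> n) \<phi>) \<longlonglongrightarrow> integral\<^sup>L \<nu> \<phi>)"

lemma sets_empirical_measure [simp]:
  fixes x :: "nat \<Rightarrow> 'a::topological_space"
  shows "sets (empirical_measure x n) = sets borel"
  unfolding empirical_measure_def
  using sets.sigma_sets_eq[of "borel :: 'a measure"] by (simp add: sets_measure_of)

lemma emeasure_empirical_measure:
  fixes x :: "nat \<Rightarrow> 'a::topological_space"
  assumes "B \<in> sets borel"
  shows "emeasure (empirical_measure x n) B
    = (\<Sum>k = 1..n. emeasure (return borel (x k)) B) / of_nat n"
proof -
  let ?m = "\<lambda>B. (\<Sum>k = 1..n. emeasure (return borel (x k)) B) / of_nat n"
  have "countably_additive (sets borel) ?m"
  proof (rule countably_additiveI)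
    fix A :: "nat \<Rightarrow> 'a set"
    assume A: "range A \<subseteq> sets borel" "disjoint_family A" "(\<Union>i. A i) \<in> sets borel"
    have "(\<Sum>i. ?m (A i)) = (\<Sum>i. \<Sum>k = 1..n. emeasure (return borel (x k)) (A i)) / of_nat n"
      by (simp add: divide_ennreal_def)
    also have "(\<Sum>i. \<Sum>k = 1..n. emeasure (return borel (x k)) (A i))
        = (\<Sum>k = 1..n. \<Sum>i. emeasure (return borel (x k)) (A i))"
      by (rule suminf_sum) simp
    also have "\<dots> = (\<Sum>k = 1..n. emeasure (return borel (x k)) (\<Union>i. A i))"
      using A by (intro sum.cong refl suminf_emeasure) auto
    finally show "(\<Sum>i. ?m (A i)) = ?m (\<Union>i. A i)" .
  qed
  moreover have "positive (sets borel) ?m"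
    by (simp add: positive_def divide_ennreal_def)
  ultimately show ?thesis
    unfolding empirical_measure_def
    using emeasure_measure_of_sigma[of UNIV "sets borel" ?m B] assms
      sets.sigma_algebra_axioms[of "borel :: 'a measure"] by simp
qed

end

theory Submission
  imports Defs "HOL-Library.Sublist" "HOL-Library.Discrete_Functions"
begin

text \<open>
  The component \<open>v\<close> of \<open>f\<^sup>a K\<close> depends on \<open>a\<close> only through \<open>a v\<close>.  Hence constant addresses show that
  all components of the set attractor agree, and the invariance of the probabilities under
  \<open>a \<mapsto> a \<circ> s\<close>, for \<open>s\<close> a transposition, shows that all marginals of the measure attractor agree.

  The ergodic statement holds for every contractive IFS on a compact space.  The number of occurrences
  of a word \<open>c w\<close> in the random address sequence differs from \<open>p c\<close> times the number of occurrences
  of \<open>w\<close> by a sum of bounded orthogonal martingale differences, so by induction almost surely every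
  word occurs with its expected frequency.  By contraction, the last \<open>m\<close> letters determine the current
  point up to \<open>l\<^sup>m\<close> times the diameter.  So the word frequencies determine the averages of
  all continuous functions simultaneously, and the exceptional null set does not depend on the
  function.
\<close>

section \<open>Compactness of hyperspaces and tuples\<close>

text \<open>A compact set contains a nearest point, so the infimum is attained. This frees Hausdorff
  estimates from infima and suprema.\<close>

lemma infdist_le_iff_compact:
  fixes B :: "'a::metric_space set"
  assumes "compact B" "B \<noteq> {}"
  shows "infdist a B \<le> e \<longleftrightarrow> (\<exists>b\<in>B. dist a b \<le> e)"
proof
  assume le: "infdist a B \<le> e"
  obtain b where b: "b \<in> B" "\<forall>c\<in>B. dist a b \<le> dist a c"
    using continuous_attains_inf[OF assms, OF continuous_on_dist[OF continuous_on_const continuous_on_id]]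
    by metis
  then have "dist a b \<le> infdist a B"
    using assms(2) by (simp add: infdist_notempty cINF_greatest)
  with le b show "\<exists>b\<in>B. dist a b \<le> e" by force
next
  assume "\<exists>b\<in>B. dist a b \<le> e"
  then show "infdist a B \<le> e" by (blast intro: infdist_le order_trans)
qed

lemma dist_hyperspace_le_iff:
  "dist K L \<le> e \<longleftrightarrow>
    (\<forall>a\<in>hset K. \<exists>b\<in>hset L. dist a b \<le> e) \<and> (\<forall>b\<in>hset L. \<exists>a\<in>hset K. dist a b \<le> e)"
  unfolding dist_hyperspace_def
  by (subst hausdorff_dist_le_iff)
    (simp_all add: hset_compact hset_nonempty infdist_le_iff_compact dist_commute)

text \<open>A Cauchy sequence of compact sets converges to the set of all points approached by its
  members infinitely often; compactness of the base space supplies such points.\<close>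

lemma complete_hyperspace:
  assumes "compact (UNIV :: 'x::metric_space set)"
  shows "uniform_space_class.complete (UNIV :: 'x hyperspace set)"
  unfolding complete_def
proof (intro allI impI)
  fix K :: "nat \<Rightarrow> 'x hyperspace"
  assume "(\<forall>n. K n \<in> UNIV) \<and> Cauchy K"
  then have cauchy: "\<exists>N. \<forall>m\<ge>N. \<forall>n\<ge>N. dist (K m) (K n) < e" if "e > 0" for e
    using that by (auto simp: Cauchy_def)
  \<comment> \<open>Topological upper limit: \<open>x\<close> lies in \<open>L\<close> iff each
    neighbourhood of \<open>x\<close> meets \<open>hset (K k)\<close> for arbitrarily large
    \<open>k\<close>.\<close>
  define L where "L = (\<Inter>n. closure (\<Union>k\<in>{n..}. hset (K k)))"
  have "closed L" unfolding L_def by auto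
  then have compact: "compact L"
    using assms compact_Int_closed[of UNIV L] by simp
  \<comment> \<open>Follow \<open>y\<close> through the later sets by points \<open>z k\<close>
    within \<open>e\<close>; a cluster point of these lies in \<open>L\<close> and is still within
    \<open>e\<close> of \<open>y\<close>.\<close>
  have near_L: "\<exists>x\<in>L. dist y x \<le> e"
    if N: "\<forall>m\<ge>N. \<forall>n\<ge>N. dist (K m) (K n) < e" and n: "n \<ge> N" and y: "y \<in> hset (K n)" for N n y e
  proof -
    have "\<exists>z\<in>hset (K k). dist y z \<le> e" if "k \<ge> N" for k
      using N n y that dist_hyperspace_le_iff[of "K n" "K k" e] by (meson less_imp_le)
    then obtain z where z: "\<And>k. k \<ge> N \<Longrightarrow> z k \<in> hset (K k) \<and> dist y (z k) \<le> e"
      by metis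
    obtain x r where r: "strict_mono r" and lim: "(z \<circ> r) \<longlonglongrightarrow> x"
      using assms unfolding compact_def by blast
    have "x \<in> closure (\<Union>k\<in>{m..}. hset (K k))" for m
    proof (rule Lim_in_closed_set[OF closed_closure _ _ lim])
      show "\<forall>\<^sub>F i in sequentially. (z \<circ> r) i \<in> closure (\<Union>k\<in>{m..}. hset (K k))"
        unfolding eventually_sequentially
      proof (intro exI allI impI)
        fix i assume "max m N \<le> i"
        then have "max m N \<le> r i" using seq_suble[OF r, of i] by simp
        then show "(z \<circ> r) i \<in> closure (\<Union>k\<in>{m..}. hset (K k))"
          using z[of "r i"] by (intro subsetD[OF closure_subset]) auto
      qed
    qed simp
    then have "x \<in> L" by (simp add: L_def)
    moreover have "dist y x \<le> e"
    proof (rule tendsto_upperbound)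
      show "(\<lambda>i. dist y ((z \<circ> r) i)) \<longlonglongrightarrow> dist y x" using lim by (intro tendsto_intros)
      show "\<forall>\<^sub>F i in sequentially. dist y ((z \<circ> r) i) \<le> e"
        unfolding eventually_sequentially
      proof (intro exI allI impI)
        fix i assume "N \<le> i"
        then show "dist y ((z \<circ> r) i) \<le> e" using z[of "r i"] seq_suble[OF r, of i] by simp
      qed
    qed simp
    ultimately show ?thesis by blast
  qed
  have "L \<noteq> {}"
  proof -
    obtain N where N: "\<forall>m\<ge>N. \<forall>n\<ge>N. dist (K m) (K n) < 1" using cauchy[of 1] by auto
    obtain y where "y \<in> hset (K N)" using hset_nonempty by blast
    then show ?thesis using near_L[OF N, of N y] by auto
  qed
  then have L: "hset (Hyp L) = L" using compact by (simp add: hset_Hyp)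
  have "K \<longlonglongrightarrow> Hyp L"
    unfolding LIMSEQ_def
  proof (intro allI impI)
    fix r :: real assume "r > 0"
    define e where "e = r / 3"
    have e: "e > 0" "2 * e < r" using \<open>r > 0\<close> by (auto simp: e_def)
    obtain N where N: "\<forall>m\<ge>N. \<forall>n\<ge>N. dist (K m) (K n) < e" using cauchy e by blast
    have "dist (K n) (Hyp L) < r" if n: "n \<ge> N" for n
    proof -
      \<comment> \<open>Conversely, \<open>x\<close> is within \<open>e\<close> of a point of some
        later \<open>K k\<close>, and \<open>K k\<close> is within \<open>e\<close> of
        \<open>K n\<close>; hence the factor 2 and the choice \<open>e = r / 3\<close>.\<close>
      have "\<exists>a\<in>hset (K n). dist a x \<le> 2 * e" if "x \<in> L" for x
      proof -
        have "x \<in> closure (\<Union>k\<in>{n..}. hset (K k))" using that by (simp add: L_def)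
        then obtain k y where k: "k \<ge> n" "y \<in> hset (K k)" "dist y x < e"
          using e(1) unfolding closure_approachable by blast
        have "dist (K n) (K k) \<le> e" using N n k(1) by (meson less_imp_le order_trans)
        then obtain a where "a \<in> hset (K n)" "dist a y \<le> e"
          using k(2) unfolding dist_hyperspace_le_iff by blast
        then show ?thesis
          using dist_triangle[of a x y] k(3) by (intro bexI[of _ a]) linarith+
      qed
      moreover have "\<exists>x\<in>L. dist y x \<le> 2 * e" if "y \<in> hset (K n)" for y
        using near_L[OF N n that] e(1) by force
      ultimately have "dist (K n) (Hyp L) \<le> 2 * e"
        by (simp add: dist_hyperspace_le_iff L)
      with e show ?thesis by linarith
    qed
    then show "\<exists>N. \<forall>n\<ge>N. dist (K n) (Hyp L) < r" by blast
  qed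
  then show "\<exists>l\<in>UNIV. K \<longlonglongrightarrow> l" by blast
qed

text \<open>Total boundedness: the non-empty subsets of a finite \<open>e / 2\<close>-net of the
  base space form a finite \<open>e\<close>-net of the hyperspace.\<close>

lemma compact_hyperspace:
  assumes "compact (UNIV :: 'x::metric_space set)"
  shows "compact (UNIV :: 'x hyperspace set)"
  unfolding compact_eq_totally_bounded
proof (intro conjI complete_hyperspace[OF assms] allI impI)
  fix e :: real assume e: "e > 0"
  then obtain S :: "'x set" where S: "finite S" "UNIV \<subseteq> (\<Union>x\<in>S. ball x (e / 2))"
    using assms unfolding compact_eq_totally_bounded by (meson half_gt_zero)
  have "K \<in> (\<Union>T\<in>Hyp ` (Pow S - {{}}). ball T e)" for K :: "'x hyperspace"
  proof -
    \<comment> \<open>Only net points near \<open>K\<close> are kept, since the Hausdorff distance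
      also requires each point of \<open>T\<close> to be close to \<open>K\<close>.\<close>
    define T where "T = {s\<in>S. \<exists>x\<in>hset K. dist s x < e / 2}"
    have net: "\<exists>s\<in>T. dist s x < e / 2" if "x \<in> hset K" for x
    proof -
      have "x \<in> (\<Union>s\<in>S. ball s (e / 2))" using S(2) by blast
      then obtain s where "s \<in> S" "dist s x < e / 2" by (auto simp only: UN_iff mem_ball)
      then show ?thesis using that by (auto simp: T_def)
    qed
    then have ne: "T \<noteq> {}" using hset_nonempty[of K] by blast
    have "finite T" using S(1) by (simp add: T_def)
    then have hset_T: "hset (Hyp T) = T" using ne by (intro hset_Hyp finite_imp_compact)
    have "dist (Hyp T) K \<le> e / 2"
      unfolding dist_hyperspace_le_iff hset_T
      using net by (force simp: T_def)
    then have "dist (Hyp T) K < e" using e by linarith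
    moreover have "T \<in> Pow S - {{}}" using ne by (auto simp: T_def)
    ultimately show ?thesis by auto
  qed
  then show "\<exists>C. finite C \<and> (UNIV :: 'x hyperspace set) \<subseteq> (\<Union>x\<in>C. ball x e)"
    using S(1) by (intro exI[of _ "Hyp ` (Pow S - {{}})"]) auto
qed

section \<open>The maximum metric on tuples\<close>

lemma dist_tuple_le_iff: "dist x y \<le> e \<longleftrightarrow> (\<forall>v. dist (entry x v) (entry y v) \<le> e)"
  unfolding dist_tuple_def by (subst Max_le_iff) auto

lemma dist_entry_le: "dist (entry x v) (entry y v) \<le> dist x y"
  using dist_tuple_le_iff[of x y "dist x y"] by simp

lemma continuous_on_entry: "continuous_on S (\<lambda>x. entry x v)"
  unfolding continuous_on_iff using dist_entry_le le_less_trans by blast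

text \<open>With finitely many coordinates, coordinatewise convergence is already uniform in the
  coordinate, which links the product topology to the maximum metric.\<close>

lemma continuous_on_Tup:
  "continuous_on S (Tup :: ('v::finite \<Rightarrow> 'h::metric_space) \<Rightarrow> ('h, 'v) tuple)"
  unfolding continuous_on_def
proof (intro ballI tendstoI)
  fix x :: "'v \<Rightarrow> 'h" and e :: real assume "x \<in> S" "e > 0"
  have "((\<lambda>y. y v) \<longlongrightarrow> x v) (at x within S)" for v
    using continuous_on_product_then_coordinatewise[OF continuous_on_id, of S v] \<open>x \<in> S\<close>
    by (simp add: continuous_on_def)
  then have "\<forall>\<^sub>F y in at x within S. \<forall>v. dist (y v) (x v) < e / 2"
    using \<open>e > 0\<close> by (intro eventually_all_finite tendstoD) auto
  then show "\<forall>\<^sub>F y in at x within S. dist (Tup y) (Tup x) < e"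
  proof eventually_elim
    case (elim y)
    then have "dist (Tup y) (Tup x) \<le> e / 2"
      unfolding dist_tuple_le_iff entry_Tup by (meson less_imp_le)
    with \<open>e > 0\<close> show ?case by linarith
  qed
qed

text \<open>Tychonoff's theorem gives compactness of the function space, and \<open>Tup\<close>
  carries it over as a continuous surjection.\<close>

lemma compact_tuple:
  assumes "compact (UNIV :: 'h::metric_space set)"
  shows "compact (UNIV :: ('h, 'v::finite) tuple set)"
proof -
  have "compact_space (euclidean :: 'h topology)" using assms by (simp add: compact_space_def)
  then have "compact_space (product_topology (\<lambda>_::'v. euclidean :: 'h topology) UNIV)"
    by (simp add: compact_space_product_topology)
  then have "compact (UNIV :: ('v \<Rightarrow> 'h) set)"
    by (simp add: euclidean_product_topology compact_space_def)
  then have "compact (range (Tup :: ('v \<Rightarrow> 'h) \<Rightarrow> ('h, 'v) tuple))"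
    by (rule compact_continuous_image[OF continuous_on_Tup])
  moreover have "range (Tup :: ('v \<Rightarrow> 'h) \<Rightarrow> ('h, 'v) tuple) = UNIV"
    by (rule surjI) (rule entry_inverse)
  ultimately show ?thesis by simp
qed

section \<open>Contraction estimates for unions of images\<close>

lemma hset_Hyp_UN_image:
  fixes h :: "'i::finite \<Rightarrow> 'x::metric_space \<Rightarrow> 'y::metric_space"
  assumes "\<And>i. l-lipschitz_on UNIV (h i)"
  shows "hset (Hyp (\<Union>i. h i ` hset (K i))) = (\<Union>i. h i ` hset (K i))"
proof (rule hset_Hyp)
  have "continuous_on UNIV (h i)" for i using assms by (rule lipschitz_on_continuous_on)
  then show "compact (\<Union>i. h i ` hset (K i))"
    by (intro compact_UN compact_continuous_image hset_compact) (auto intro: continuous_on_subset)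
  show "(\<Union>i. h i ` hset (K i)) \<noteq> {}" by (auto simp: hset_nonempty)
qed

text \<open>Points are matched within the same index \<open>i\<close>, so the union costs nothing.
  Varying \<open>K i\<close> serve for the components of \<open>super_map\<close>, a constant family
  for the Hutchinson operator of an IFS.\<close>

lemma dist_Hyp_UN_image_le:
  fixes h :: "'i::finite \<Rightarrow> 'x::metric_space \<Rightarrow> 'y::metric_space"
  assumes lip: "\<And>i. l-lipschitz_on UNIV (h i)" and le: "\<And>i. dist (K i) (L i) \<le> e"
  shows "dist (Hyp (\<Union>i. h i ` hset (K i))) (Hyp (\<Union>i. h i ` hset (L i))) \<le> l * e"
proof -
  have step: "dist (h i x) (h i y) \<le> l * e" if "dist x y \<le> e" for i x y
    using lipschitz_onD[OF lip[of i], of x y] lipschitz_on_nonneg[OF lip[of i]] that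
      mult_left_mono[of "dist x y" e l] by simp
  have "\<exists>b\<in>\<Union>j. h j ` hset (L j). dist (h i x) b \<le> l * e" if "x \<in> hset (K i)" for i x
    using le[of i] that step unfolding dist_hyperspace_le_iff by blast
  moreover have "\<exists>a\<in>\<Union>j. h j ` hset (K j). dist a (h i y) \<le> l * e" if "y \<in> hset (L i)" for i y
    using le[of i] that step unfolding dist_hyperspace_le_iff by blast
  ultimately show ?thesis
    unfolding dist_hyperspace_le_iff hset_Hyp_UN_image[OF lip] by auto
qed

lemma lipschitz_on_super_map:
  fixes f :: "'n::finite \<Rightarrow> 'm::finite \<Rightarrow> 'x::metric_space \<Rightarrow> 'x"
    and a :: "('n, 'm, 'v::finite) address"
  assumes "0 \<le> l" "\<And>n m. l-lipschitz_on UNIV (f n m)"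
  shows "l-lipschitz_on UNIV (super_map f a)"
proof (rule lipschitz_onI[OF _ assms(1)])
  fix K L :: "('x hyperspace, 'v) tuple"
  show "dist (super_map f a K) (super_map f a L) \<le> l * dist K L"
    unfolding dist_tuple_le_iff super_map_def entry_Tup
    by (intro allI dist_Hyp_UN_image_le assms dist_entry_le)
qed

section \<open>Averages of bounded orthogonal random variables\<close>

text \<open>After the last square \<open>j\<^sup>2\<close> come at most \<open>2 * j\<close> further
  terms. As these are bounded, they are negligible against \<open>j\<^sup>2\<close>.\<close>

lemma average_tendsto_0_if_square_subsequence:
  fixes d :: "nat \<Rightarrow> real"
  assumes bound: "\<And>k. \<bar>d k\<bar> \<le> B"
    and sub: "(\<lambda>j. (\<Sum>k<j\<^sup>2. d k) / real (j\<^sup>2)) \<longlonglongrightarrow> 0"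
  shows "(\<lambda>n. (\<Sum>k<n. d k) / real n) \<longlonglongrightarrow> 0"
proof -
  \<comment> \<open>\<open>r n\<close> is the root of the largest square not exceeding
    \<open>n\<close>.\<close>
  define r where "r = floor_sqrt"
  have r: "filterlim r at_top sequentially"
    unfolding filterlim_at_top eventually_sequentially r_def
    by (metis le_floor_sqrtI order_refl mono_floor_sqrt' order_trans)
  have B: "0 \<le> B" using bound[of 0] by linarith
  have "\<bar>(\<Sum>k<n. d k) / real n\<bar> \<le> \<bar>(\<Sum>k<(r n)\<^sup>2. d k) / real ((r n)\<^sup>2)\<bar> + 2 * B / real (r n)"
    if n: "n \<ge> 1" for n
  proof -
    define j where "j = r n"
    have "0 < j" using n by (simp add: j_def r_def)
    then have j: "j \<ge> 1" by linarith
    have j': "j\<^sup>2 \<le> n" "n < (Suc j)\<^sup>2"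
      using Suc_floor_sqrt_power2_gt[of n] by (simp_all add: j_def r_def)
    have "(\<Sum>k<n. d k) = (\<Sum>k<j\<^sup>2. d k) + (\<Sum>k\<in>{j\<^sup>2..<n}. d k)"
      using j'(1) by (subst sum.union_disjoint[symmetric]) (auto intro: sum.cong)
    moreover have "\<bar>\<Sum>k\<in>{j\<^sup>2..<n}. d k\<bar> \<le> 2 * B * real j"
    proof -
      have "\<bar>\<Sum>k\<in>{j\<^sup>2..<n}. d k\<bar> \<le> (\<Sum>k\<in>{j\<^sup>2..<n}. B)"
        using bound by (intro order_trans[OF sum_abs] sum_mono)
      also have "\<dots> = real (n - j\<^sup>2) * B" by simp
      also have "\<dots> \<le> real (2 * j) * B"
        using j'(2) B by (intro mult_right_mono of_nat_mono) (auto simp: power2_eq_square)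
      finally show ?thesis by (simp add: mult_ac)
    qed
    ultimately have "\<bar>\<Sum>k<n. d k\<bar> \<le> \<bar>\<Sum>k<j\<^sup>2. d k\<bar> + 2 * B * real j" by linarith
    then have "\<bar>(\<Sum>k<n. d k) / real n\<bar> \<le> (\<bar>\<Sum>k<j\<^sup>2. d k\<bar> + 2 * B * real j) / real n"
      by (simp add: divide_right_mono)
    also have "\<dots> \<le> (\<bar>\<Sum>k<j\<^sup>2. d k\<bar> + 2 * B * real j) / real (j\<^sup>2)"
      using n j j' B by (intro divide_left_mono) auto
    also have "\<dots> = \<bar>(\<Sum>k<j\<^sup>2. d k) / real (j\<^sup>2)\<bar> + 2 * B / real j"
      using j by (simp add: add_divide_distrib power2_eq_square)
    finally show ?thesis unfolding j_def .
  qed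
  then have "\<forall>\<^sub>F n in sequentially. \<bar>(\<Sum>k<n. d k) / real n\<bar>
      \<le> \<bar>(\<Sum>k<(r n)\<^sup>2. d k) / real ((r n)\<^sup>2)\<bar> + 2 * B / real (r n)"
    unfolding eventually_sequentially by blast
  moreover have "(\<lambda>n. \<bar>(\<Sum>k<(r n)\<^sup>2. d k) / real ((r n)\<^sup>2)\<bar> + 2 * B / real (r n)) \<longlonglongrightarrow> 0"
  proof -
    have "(\<lambda>j. \<bar>(\<Sum>k<j\<^sup>2. d k) / real (j\<^sup>2)\<bar> + 2 * B / real j) \<longlonglongrightarrow> 0 + 0"
      using sub by (intro tendsto_add tendsto_rabs_zero lim_const_over_n)
    from filterlim_compose[OF this r] show ?thesis by simp
  qed
  ultimately show ?thesis
    unfolding real_norm_def[symmetric] by (rule Lim_null_comparison)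
qed

text \<open>Orthogonality bounds the second moment of the \<open>n\<close>-th partial sum by
  \<open>n * B\<^sup>2\<close>. Along squares, the second moments of the averages are therefore
  summable, which forces almost sure convergence; boundedness handles the indices between
  squares.\<close>

lemma (in prob_space) bounded_orthogonal_SLLN:
  fixes D :: "nat \<Rightarrow> 'a \<Rightarrow> real"
  assumes [measurable]: "\<And>k. random_variable borel (D k)"
    and bound: "\<And>k \<omega>. \<bar>D k \<omega>\<bar> \<le> B"
    and orth: "\<And>j k. j < k \<Longrightarrow> expectation (\<lambda>\<omega>. D j \<omega> * D k \<omega>) = 0"
  shows "AE \<omega> in M. (\<lambda>n. (\<Sum>k<n. D k \<omega>) / real n) \<longlonglongrightarrow> 0"
proof -
  have B: "0 \<le> B" using bound[of 0 undefined] by linarith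
  have prod_bound: "\<bar>D j \<omega> * D k \<omega>\<bar> \<le> B\<^sup>2" for j k \<omega>
    unfolding abs_mult power2_eq_square using bound B by (intro mult_mono) auto
  have int: "integrable M (\<lambda>\<omega>. D j \<omega> * D k \<omega>)" for j k
    using prod_bound by (intro integrable_const_bound[where B = "B\<^sup>2"]) auto
  have int_square: "integrable M (\<lambda>\<omega>. (\<Sum>k<n. D k \<omega>)\<^sup>2)" for n
    using int by (simp add: power2_eq_square sum_product)
  have orth': "expectation (\<lambda>\<omega>. D j \<omega> * D k \<omega>) = 0" if "j \<noteq> k" for j k
    using that orth[of j k] orth[of k j] by (cases "j < k") (auto simp: mult.commute)
  have second_moment: "expectation (\<lambda>\<omega>. (\<Sum>k<n. D k \<omega>)\<^sup>2) \<le> real n * B\<^sup>2" for n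
  proof -
    have "expectation (\<lambda>\<omega>. (\<Sum>k<n. D k \<omega>)\<^sup>2)
        = (\<Sum>j<n. \<Sum>k<n. expectation (\<lambda>\<omega>. D j \<omega> * D k \<omega>))"
      using int by (simp add: power2_eq_square sum_product)
    also have "\<dots> = (\<Sum>j<n. \<Sum>k<n. if k = j then expectation (\<lambda>\<omega>. D j \<omega> * D j \<omega>) else 0)"
      using orth' by (intro sum.cong) auto
    also have "\<dots> = (\<Sum>j<n. expectation (\<lambda>\<omega>. D j \<omega> * D j \<omega>))" by simp
    also have "\<dots> \<le> (\<Sum>j<n. B\<^sup>2)"
    proof (intro sum_mono)
      fix j
      have "expectation (\<lambda>\<omega>. D j \<omega> * D j \<omega>) \<le> expectation (\<lambda>_. B\<^sup>2)"
        using prod_bound[of j _ j] int by (intro integral_mono) auto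
      then show "expectation (\<lambda>\<omega>. D j \<omega> * D j \<omega>) \<le> B\<^sup>2" by (simp add: prob_space)
    qed
    finally show ?thesis by simp
  qed
  \<comment> \<open>Squared averages along the squares; \<open>Suc j\<close> keeps the divisor
    positive.\<close>
  define U where "U j \<omega> = ((\<Sum>k<(Suc j)\<^sup>2. D k \<omega>) / real ((Suc j)\<^sup>2))\<^sup>2" for j \<omega>
  have [measurable]: "random_variable borel (U j)" for j unfolding U_def by measurable
  have U_int: "(\<integral>\<^sup>+\<omega>. ennreal (U j \<omega>) \<partial>M) \<le> ennreal (B\<^sup>2 * inverse ((real (Suc j))\<^sup>2))" for j
  proof -
    let ?n = "(Suc j)\<^sup>2"
    have "integrable M (U j)"
      unfolding U_def power_divide by (intro integrable_divide_zero int_square)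
    moreover have "0 \<le> U j \<omega>" for \<omega> by (simp add: U_def)
    ultimately have "(\<integral>\<^sup>+\<omega>. ennreal (U j \<omega>) \<partial>M) = ennreal (expectation (U j))"
      by (intro nn_integral_eq_integral) auto
    also have "expectation (U j) = expectation (\<lambda>\<omega>. (\<Sum>k<?n. D k \<omega>)\<^sup>2) / (real ?n)\<^sup>2"
      unfolding U_def power_divide by simp
    also have "\<dots> \<le> real ?n * B\<^sup>2 / (real ?n)\<^sup>2"
      by (intro divide_right_mono second_moment) simp
    also have "\<dots> = B\<^sup>2 * inverse ((real (Suc j))\<^sup>2)"
    proof -
      have "N * b / N\<^sup>2 = b * inverse N" if "N \<noteq> 0" for N b :: real
        using that by (simp add: power2_eq_square field_simps)
      from this[of "real ?n" "B\<^sup>2"] show ?thesis by (simp del: of_nat_Suc)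
    qed
    finally show ?thesis by (simp add: ennreal_leI)
  qed
  have summable: "summable (\<lambda>j. B\<^sup>2 * inverse ((real (Suc j))\<^sup>2))"
    using inverse_power_summable[of 2, where 'a = real]
    by (intro summable_mult) (simp add: summable_Suc_iff[where f = "\<lambda>j. inverse ((real j)\<^sup>2)"] del: of_nat_Suc)
  \<comment> \<open>The mean of the whole series is finite, so almost surely the series converges
    and its terms tend to 0.\<close>
  have "(\<integral>\<^sup>+\<omega>. (\<Sum>j. ennreal (U j \<omega>)) \<partial>M) = (\<Sum>j. \<integral>\<^sup>+\<omega>. ennreal (U j \<omega>) \<partial>M)"
    by (intro nn_integral_suminf) auto
  also have "\<dots> \<le> (\<Sum>j. ennreal (B\<^sup>2 * inverse ((real (Suc j))\<^sup>2)))"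
    by (intro suminf_le U_int) auto
  also have "\<dots> = ennreal (\<Sum>j. B\<^sup>2 * inverse ((real (Suc j))\<^sup>2))"
    by (rule suminf_ennreal2[OF _ summable]) (simp del: of_nat_Suc)
  also have "\<dots> < \<infinity>" by simp
  finally have "AE \<omega> in M. (\<Sum>j. ennreal (U j \<omega>)) \<noteq> \<infinity>"
    by (intro nn_integral_PInf_AE) auto
  then show ?thesis
  proof eventually_elim
    case (elim \<omega>)
    have "summable (\<lambda>j. U j \<omega>)"
      using elim by (intro summable_suminf_not_top) (auto simp: U_def)
    from tendsto_real_sqrt[OF summable_LIMSEQ_zero[OF this]]
    have "(\<lambda>j. (\<Sum>k<(Suc j)\<^sup>2. D k \<omega>) / real ((Suc j)\<^sup>2)) \<longlonglongrightarrow> 0"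
      unfolding U_def real_sqrt_abs real_sqrt_zero by (simp only: tendsto_rabs_zero_iff)
    then have "(\<lambda>j. (\<Sum>k<j\<^sup>2. D k \<omega>) / real (j\<^sup>2)) \<longlonglongrightarrow> 0"
      by (rule LIMSEQ_imp_Suc)
    then show ?case using bound by (rule average_tendsto_0_if_square_subsequence[rotated])
  qed
qed

section \<open>Frequencies of words\<close>

text \<open>Most recent letter first, so that extending a word on the left is one more step in time.\<close>

primrec history :: "(nat \<Rightarrow> 'i) \<Rightarrow> nat \<Rightarrow> 'i list" where
  "history s 0 = []"
| "history s (Suc k) = s (Suc k) # history s k"

lemma length_history [simp]: "length (history s k) = k"
  by (induction k) auto

lemma history_cong: "(\<And>i. 1 \<le> i \<Longrightarrow> i \<le> k \<Longrightarrow> s i = t i) \<Longrightarrow> history s k = history t k"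
  by (induction k) auto

text \<open>The two sums differ by the telescoped boundary term \<open>x 0 - x n\<close>, which is
  bounded and vanishes after division by \<open>n\<close>.\<close>

lemma average_Suc_iff:
  fixes x :: "nat \<Rightarrow> real"
  assumes bound: "\<And>k. \<bar>x k\<bar> \<le> B"
  shows "(\<lambda>n. (\<Sum>k<n. x (Suc k)) / real n) \<longlonglongrightarrow> c \<longleftrightarrow> (\<lambda>n. (\<Sum>k<n. x k) / real n) \<longlonglongrightarrow> c"
proof -
  have "(\<lambda>n. (\<Sum>k<n. x k) / real n - (\<Sum>k<n. x (Suc k)) / real n) \<longlonglongrightarrow> 0"
  proof (rule Lim_null_comparison)
    have "norm ((\<Sum>k<n. x k) / real n - (\<Sum>k<n. x (Suc k)) / real n) \<le> 2 * B / real n" for n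
    proof -
      have "(\<Sum>k<n. x k) - (\<Sum>k<n. x (Suc k)) = x 0 - x n"
        by (induction n) auto
      moreover have "\<bar>x 0 - x n\<bar> \<le> 2 * B" using bound[of 0] bound[of n] by linarith
      ultimately show ?thesis
        by (simp add: diff_divide_distrib[symmetric] divide_right_mono)
    qed
    then show "\<forall>\<^sub>F n in sequentially.
        norm ((\<Sum>k<n. x k) / real n - (\<Sum>k<n. x (Suc k)) / real n) \<le> 2 * B / real n"
      by simp
    show "(\<lambda>n. 2 * B / real n) \<longlonglongrightarrow> 0" by (rule lim_const_over_n)
  qed
  from Lim_transform_eq[OF this] show ?thesis by simp
qed

text \<open>Letters are indexed from 1 to match the chaos game, and \<open>history\<close> never
  reads \<open>a 0\<close>.\<close>

locale iid_sequence = prob_space +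
  fixes a :: "nat \<Rightarrow> 'a \<Rightarrow> 'i::finite" and p :: "'i \<Rightarrow> real"
  assumes indep: "indep_vars (\<lambda>_. count_space UNIV) a {1..}"
    and prob_a: "\<And>k c. k \<ge> 1 \<Longrightarrow> prob {\<omega> \<in> space M. a k \<omega> = c} = p c"
begin

lemma p_bounds: "0 \<le> p c" "p c \<le> 1"
  unfolding prob_a[of 1, OF order_refl, symmetric] by auto

lemma measurable_a: "k \<ge> 1 \<Longrightarrow> a k \<in> M \<rightarrow>\<^sub>M count_space UNIV"
  using indep unfolding indep_vars_def by auto

lemma measurable_history: "(\<lambda>\<omega>. history (\<lambda>i. a i \<omega>) k) \<in> M \<rightarrow>\<^sub>M count_space UNIV"
proof (induction k)
  case (Suc k)
  have "(\<lambda>\<omega>. (\<lambda>(x, xs). x # xs) (a (Suc k) \<omega>, history (\<lambda>i. a i \<omega>) k)) \<in> M \<rightarrow>\<^sub>M count_space UNIV"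
    using Suc measurable_a[of "Suc k"]
    by (intro measurable_compose[OF measurable_Pair]) (auto simp: pair_measure_countable)
  then show ?case by simp
qed simp

text \<open>\<open>G\<close> sees only letters before time \<open>k\<close>, hence is independent of
  the centred indicator of letter \<open>k\<close>, and the expectation factors. This is the
  martingale difference property behind orthogonality.\<close>

lemma expectation_letter_times_past:
  assumes "k \<ge> 1" "\<And>s t. (\<And>i. 1 \<le> i \<Longrightarrow> i < k \<Longrightarrow> s i = t i) \<Longrightarrow> G s = G t"
    and bound: "\<And>s. \<bar>G s\<bar> \<le> B"
  shows "expectation (\<lambda>\<omega>. (G (\<lambda>i. a i \<omega>) :: real) * (indicat_real {c} (a k \<omega>) - p c)) = 0"
proof -
  let ?R = "\<lambda>A \<omega>. restrict (\<lambda>i. a i \<omega>) A" and ?h = "\<lambda>s. indicat_real {c} (s k) - p c"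
  let ?P = "\<lambda>A. PiM A (\<lambda>_. count_space (UNIV :: 'i set))"
  \<comment> \<open>A finite product of finite discrete spaces is discrete, so every function on it
    is measurable.\<close>
  have meas: "F \<in> borel_measurable (?P A)" if "finite A" for F :: "(nat \<Rightarrow> 'i) \<Rightarrow> real" and A
    using that by (simp add: count_space_PiM_finite)
  have "indep_var (?P {1..<k}) (?R {1..<k}) (?P {k}) (?R {k})"
    using indep assms(1) by (intro indep_var_restrict[where I = "{1..}"]) auto
  then have "indep_var borel (G \<circ> ?R {1..<k}) borel (?h \<circ> ?R {k})"
    by (rule indep_var_compose) (auto intro: meas)
  moreover have "G \<circ> ?R {1..<k} = (\<lambda>\<omega>. G (\<lambda>i. a i \<omega>))"
    by (auto simp: fun_eq_iff intro: assms(2))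
  moreover have "?h \<circ> ?R {k} = (\<lambda>\<omega>. indicat_real {c} (a k \<omega>) - p c)"
    by (auto simp: fun_eq_iff)
  ultimately have indep2:
    "indep_var borel (\<lambda>\<omega>. G (\<lambda>i. a i \<omega>)) borel (\<lambda>\<omega>. indicat_real {c} (a k \<omega>) - p c)" by simp
  have ind: "(\<lambda>\<omega>. indicat_real {c} (a k \<omega>)) \<in> borel_measurable M"
    using measurable_a[OF assms(1)] by (rule measurable_compose) simp
  have int_ind: "integrable M (\<lambda>\<omega>. indicat_real {c} (a k \<omega>))"
    using ind by (intro integrable_const_bound[where B = 1]) (auto simp: indicator_def)
  have "expectation (\<lambda>\<omega>. indicat_real {c} (a k \<omega>))
      = expectation (indicat_real {\<omega> \<in> space M. a k \<omega> = c})"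
    by (intro Bochner_Integration.integral_cong) (auto simp: indicator_def)
  also have "\<dots> = p c"
    using measurable_a[OF assms(1)] by (simp add: prob_a[OF assms(1)])
  finally have "expectation (\<lambda>\<omega>. indicat_real {c} (a k \<omega>) - p c) = 0"
    using int_ind by (simp add: prob_space)
  moreover have "integrable M (\<lambda>\<omega>. G (\<lambda>i. a i \<omega>))"
    using bound indep_var_rv1[OF indep2] by (intro integrable_const_bound[where B = B]) auto
  ultimately show ?thesis
    using indep_var_lebesgue_integral[OF indep2] int_ind by simp
qed

lemma word_frequency:
  "AE \<omega> in M. (\<lambda>n. (\<Sum>k<n. of_bool (prefix w (history (\<lambda>i. a i \<omega>) k))) / real n)
    \<longlonglongrightarrow> prod_list (map p w)"
proof (induction w)
  case Nil
  have "(\<lambda>n. real n / real n) \<longlonglongrightarrow> 1"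
    by (intro tendsto_eventually) (auto simp: eventually_sequentially intro: exI[of _ 1])
  then show ?case by simp
next
  case (Cons c w)
  define I where "I w \<omega> k = (of_bool (prefix w (history (\<lambda>i. a i \<omega>) k)) :: real)" for w \<omega> k
  define G where "G j s = (of_bool (prefix w (history s j)) :: real)" for j s
  \<comment> \<open>The excess of \<open>c # w\<close> at time \<open>Suc k\<close> over
    \<open>p c\<close> times \<open>w\<close> at time \<open>k\<close>, written with the centred
    letter as a factor to expose its zero mean.\<close>
  define D where "D k \<omega> = G k (\<lambda>i. a i \<omega>) * (indicat_real {c} (a (Suc k) \<omega>) - p c)" for k \<omega>
  have "AE \<omega> in M. (\<lambda>n. (\<Sum>k<n. D k \<omega>) / real n) \<longlonglongrightarrow> 0"
  proof (rule bounded_orthogonal_SLLN[where B = 1])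
    show "random_variable borel (D k)" for k
    proof -
      have "(\<lambda>\<omega>. (\<lambda>xs. of_bool (prefix w (tl xs)) * (indicat_real {c} (hd xs) - p c))
          (history (\<lambda>i. a i \<omega>) (Suc k))) \<in> borel_measurable M"
        by (rule measurable_compose[OF measurable_history]) simp
      then show ?thesis by (simp add: D_def[abs_def] G_def)
    qed
    show "\<bar>D k \<omega>\<bar> \<le> 1" for k \<omega>
      using p_bounds[of c] by (auto simp: D_def G_def indicator_def)
    fix j k :: nat assume jk: "j < k"
    \<comment> \<open>Since \<open>j < k\<close>, all of \<open>D j\<close> is determined by letters
      up to time \<open>k\<close> and can be absorbed into the past of letter
      \<open>Suc k\<close>.\<close>
    have "expectation (\<lambda>\<omega>. (\<lambda>s. G j s * (indicat_real {c} (s (Suc j)) - p c) * G k s)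
        (\<lambda>i. a i \<omega>) * (indicat_real {c} (a (Suc k) \<omega>) - p c)) = 0"
    proof (rule expectation_letter_times_past[where B = 1])
      fix s t :: "nat \<Rightarrow> 'i" assume "\<And>i. 1 \<le> i \<Longrightarrow> i < Suc k \<Longrightarrow> s i = t i"
      then have "history s j = history t j" "history s k = history t k" "s (Suc j) = t (Suc j)"
        using jk by (auto intro!: history_cong)
      then show "G j s * (indicat_real {c} (s (Suc j)) - p c) * G k s
          = G j t * (indicat_real {c} (t (Suc j)) - p c) * G k t"
        by (simp add: G_def)
    next
      fix s show "\<bar>G j s * (indicat_real {c} (s (Suc j)) - p c) * G k s\<bar> \<le> 1"
        using p_bounds[of c] by (auto simp: G_def indicator_def)
    qed simp
    then show "expectation (\<lambda>\<omega>. D j \<omega> * D k \<omega>) = 0"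
      by (simp add: D_def mult_ac)
  qed
  with Cons show ?case
  proof eventually_elim
    case (elim \<omega>)
    have "D k \<omega> = I (c # w) \<omega> (Suc k) - p c * I w \<omega> k" for k
      by (auto simp: D_def G_def I_def indicator_def)
    then have "(\<lambda>n. (\<Sum>k<n. I (c # w) \<omega> (Suc k)) / real n - p c * ((\<Sum>k<n. I w \<omega> k) / real n)) \<longlonglongrightarrow> 0"
      using elim(2) by (simp add: sum_subtractf sum_distrib_left diff_divide_distrib)
    from tendsto_add[OF this tendsto_mult_left[OF elim(1), of "p c"]]
    have "(\<lambda>n. (\<Sum>k<n. I (c # w) \<omega> (Suc k)) / real n) \<longlonglongrightarrow> p c * prod_list (map p w)"
      by (simp add: I_def)
    \<comment> \<open>The occurrence of \<open>c # w\<close> is recorded one time step later than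
      that of \<open>w\<close>; shifting the index does not change the limit.\<close>
    then show ?case
      by (subst (asm) average_Suc_iff[where B = 1]) (auto simp: I_def)
  qed
qed

end

section \<open>Contractive iterated function systems on a compact space\<close>

text \<open>Closed sets form an intersection-stable generator of the Borel sets, and the indicator
  of a non-empty closed set is a pointwise limit of continuous functions with values in [0,1];
  dominated convergence applies.\<close>

lemma measure_eqI_integral_continuous:
  fixes \<mu> \<nu> :: "'y::metric_space measure"
  assumes "prob_space \<mu>" "prob_space \<nu>" and sets: "sets \<mu> = sets borel" "sets \<nu> = sets borel"
    and eq: "\<And>\<phi>. continuous_on UNIV \<phi> \<Longrightarrow> (\<And>y. 0 \<le> \<phi> y \<and> \<phi> y \<le> 1) \<Longrightarrow>
      (\<integral>y. (\<phi> y :: real) \<partial>\<mu>) = (\<integral>y. \<phi> y \<partial>\<nu>)"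
  shows "\<mu> = \<nu>"
proof (rule measure_eqI_generator_eq[where E = "Collect closed" and \<Omega> = UNIV and A = "\<lambda>_. UNIV"])
  interpret \<mu>: prob_space \<mu> by fact
  interpret \<nu>: prob_space \<nu> by fact
  show "Int_stable (Collect closed :: 'y set set)" by (auto simp: Int_stable_def)
  show "sets \<mu> = sigma_sets UNIV (Collect closed)" "sets \<nu> = sigma_sets UNIV (Collect closed)"
    by (simp_all add: sets borel_eq_closed)
  fix C :: "'y set" assume C: "C \<in> Collect closed"
  show "emeasure \<mu> C = emeasure \<nu> C"
  \<comment> \<open>The empty set is treated apart: \<open>infdist y {} = 0\<close> by convention,
    so the functions below would be constantly 1.\<close>
  proof (cases "C = {}")
    case False
    define \<phi> where "\<phi> n y = max 0 (1 - real n * infdist y C)" for n y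
    have range: "0 \<le> \<phi> n y \<and> \<phi> n y \<le> 1" for n y
      by (simp add: \<phi>_def infdist_nonneg)
    have cont: "continuous_on UNIV (\<phi> n)" for n
      unfolding \<phi>_def by (intro continuous_intros)
    have lim: "(\<lambda>n. \<phi> n y) \<longlonglongrightarrow> indicat_real C y" for y
    proof (cases "y \<in> C")
      case True
      then show ?thesis by (simp add: \<phi>_def)
    next
      case nC: False
      have pos: "infdist y C > 0" using C False nC infdist_pos_not_in_closed by blast
      obtain N where N: "real N * infdist y C > 1"
        using reals_Archimedean3[OF pos] by blast
      have "\<phi> n y = 0" if "n \<ge> N" for n
      proof -
        have "real n * infdist y C \<ge> real N * infdist y C"
          using that pos by (intro mult_right_mono) auto
        with N show ?thesis by (simp add: \<phi>_def)
      qed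
      then show ?thesis
        using nC by (intro tendsto_eventually) (auto simp: eventually_sequentially)
    qed
    have conv: "(\<lambda>n. \<integral>y. \<phi> n y \<partial>\<rho>) \<longlonglongrightarrow> measure \<rho> C"
      if "prob_space \<rho>" "sets \<rho> = sets borel" for \<rho>
    proof -
      interpret prob_space \<rho> by fact
      have "C \<in> sets \<rho>" using C that(2) by (simp add: borel_closed)
      moreover have "\<phi> n \<in> borel_measurable \<rho>" for n
        using borel_measurable_continuous_onI[OF cont] measurable_cong_sets[OF that(2) refl] by blast
      ultimately have "(\<lambda>n. \<integral>y. \<phi> n y \<partial>\<rho>) \<longlonglongrightarrow> (\<integral>y. indicat_real C y \<partial>\<rho>)"
        using lim range by (intro integral_dominated_convergence[where w = "\<lambda>_. 1"]) auto
      then show ?thesis using \<open>C \<in> sets \<rho>\<close> by simp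
    qed
    have "measure \<mu> C = measure \<nu> C"
      using conv[OF assms(1) sets(1)] conv[OF assms(2) sets(2)] eq[OF cont range]
      by (simp add: LIMSEQ_unique)
    then show ?thesis by (simp add: \<mu>.emeasure_eq_measure \<nu>.emeasure_eq_measure)
  qed simp
next
  show "emeasure \<mu> UNIV \<noteq> \<infinity>" for i :: nat
    using prob_space.emeasure_space_1[OF assms(1)] sets_eq_imp_space_eq[OF sets(1)] by simp
qed auto

text \<open>The first \<open>m\<close> terms contribute at most a fixed constant, which is lost
  after division by \<open>n\<close>; the others contribute at most \<open>e\<close> to the
  average.\<close>

lemma eventually_average_less:
  fixes z :: "nat \<Rightarrow> real"
  assumes small: "\<And>k. k \<ge> m \<Longrightarrow> \<bar>z k\<bar> \<le> e" and e: "0 \<le> e" "e < r"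
  shows "\<forall>\<^sub>F n in sequentially. \<bar>(\<Sum>k<n. z k) / real n\<bar> < r"
proof -
  define C where "C = (\<Sum>k<m. \<bar>z k\<bar>)"
  have sum: "\<bar>\<Sum>k<n. z k\<bar> \<le> C + real n * e" for n
  proof -
    have "\<bar>\<Sum>k<n. z k\<bar> \<le> (\<Sum>k<n. (if k < m then \<bar>z k\<bar> else 0) + e)"
      using small e by (intro order_trans[OF sum_abs] sum_mono) auto
    also have "\<dots> = (\<Sum>k\<in>{..<n} \<inter> {..<m}. \<bar>z k\<bar>) + real n * e"
      by (simp add: sum.distrib sum.If_cases lessThan_def)
    also have "(\<Sum>k\<in>{..<n} \<inter> {..<m}. \<bar>z k\<bar>) \<le> C"
      unfolding C_def by (intro sum_mono2) auto
    finally show ?thesis by simp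
  qed
  have "(\<lambda>n. C / real n) \<longlonglongrightarrow> 0" by (rule lim_const_over_n)
  then have "\<forall>\<^sub>F n in sequentially. C / real n < r - e"
    using e by (intro order_tendstoD(2)) auto
  then show ?thesis
    using eventually_gt_at_top[of 0]
  proof eventually_elim
    case (elim n)
    have "\<bar>(\<Sum>k<n. z k) / real n\<bar> \<le> (C + real n * e) / real n"
      using sum[of n] by (simp add: divide_right_mono)
    also have "\<dots> = C / real n + e" using elim(2) by (simp add: field_simps)
    finally show ?case using elim(1) by linarith
  qed
qed

definition words :: "nat \<Rightarrow> 'i list set" where
  "words m = {w. length w = m}"

lemma finite_words: "finite (words m :: 'i::finite list set)"
  using finite_lists_length_eq[of "UNIV :: 'i set" m] by (simp add: words_def)

lemma sum_words_0: "(\<Sum>w\<in>words 0. F w) = F []"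
  by (simp add: words_def)

lemma sum_words_Suc:
  fixes F :: "'i::finite list \<Rightarrow> real"
  shows "(\<Sum>w\<in>words (Suc m). F w) = (\<Sum>c\<in>UNIV. \<Sum>w\<in>words m. F (c # w))"
proof -
  have eq: "words (Suc m) = (\<lambda>(c, w). c # w) ` (UNIV \<times> words m)"
    by (auto simp: words_def length_Suc_conv image_iff)
  show ?thesis
    unfolding eq
    by (subst sum.reindex) (auto simp: sum.cartesian_product inj_on_def intro!: sum.cong)
qed

locale contractive_ifs =
  fixes g :: "'i::finite \<Rightarrow> 'y::metric_space \<Rightarrow> 'y" and l :: real and p :: "'i \<Rightarrow> real"
  assumes compact_UNIV: "compact (UNIV :: 'y set)"
    and l: "0 \<le> l" "l < 1"
    and lipschitz: "\<And>i. l-lipschitz_on UNIV (g i)"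
    and p: "\<And>i. 0 \<le> p i" "(\<Sum>i\<in>UNIV. p i) = 1"
begin

text \<open>The Hutchinson operator on the complete hyperspace of \<open>'y\<close> is an
  \<open>l\<close>-contraction, so Banach's theorem applies. This justifies the definite description
  in \<open>set_attractor\<close>.\<close>

lemma ex1_set_attractor: "\<exists>!A. A \<noteq> {} \<and> compact A \<and> A = (\<Union>i. g i ` A)"
proof -
  define H where "H A = Hyp (\<Union>i. g i ` hset A)" for A
  have hset_H: "hset (H A) = (\<Union>i. g i ` hset A)" for A
    unfolding H_def by (rule hset_Hyp_UN_image[OF lipschitz])
  have "\<exists>!A\<in>UNIV. H A = A"
  proof (rule Banach_fix)
    show "uniform_space_class.complete (UNIV :: 'y hyperspace set)"
      by (rule complete_hyperspace[OF compact_UNIV])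
    show "dist (H A) (H B) \<le> l * dist A B" for A B
      unfolding H_def by (intro dist_Hyp_UN_image_le lipschitz order_refl)
  qed (use l in auto)
  then obtain A where A: "H A = A" and uniq: "\<And>B. H B = B \<Longrightarrow> B = A" by auto
  show ?thesis
  proof (rule ex1I[of _ "hset A"])
    show "hset A \<noteq> {} \<and> compact (hset A) \<and> hset A = (\<Union>i. g i ` hset A)"
      using hset_H[of A] A hset_nonempty hset_compact by auto
    fix B assume B: "B \<noteq> {} \<and> compact B \<and> B = (\<Union>i. g i ` B)"
    then have "hset (H (Hyp B)) = hset (Hyp B)" by (simp add: hset_H hset_Hyp)
    then have "Hyp B = A" by (intro uniq) (simp add: hset_inject)
    then show "B = hset A" using B hset_Hyp[of B] by auto
  qed
qed

lemma set_attractor_fixed: "set_attractor g = (\<Union>i. g i ` set_attractor g)"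
  using theI'[OF ex1_set_attractor] unfolding set_attractor_def by blast

lemma continuous_g: "continuous_on UNIV (g i)"
  by (rule lipschitz_on_continuous_on[OF lipschitz])

lemma measurable_g: "g i \<in> borel \<rightarrow>\<^sub>M borel"
  by (rule borel_measurable_continuous_onI[OF continuous_g])

section \<open>Long compositions forget their starting point\<close>

lemma dist_foldr_le: "dist (foldr g w x) (foldr g w y) \<le> l ^ length w * dist x y"
proof (induction w)
  case (Cons c w)
  have "dist (g c (foldr g w x)) (g c (foldr g w y)) \<le> l * dist (foldr g w x) (foldr g w y)"
    by (rule lipschitz_onD[OF lipschitz]) auto
  also have "\<dots> \<le> l * (l ^ length w * dist x y)"
    using Cons l by (intro mult_left_mono) auto
  finally show ?case by (simp add: mult.assoc)
qed simp

text \<open>The space has finite diameter \<open>D\<close>, so the bound \<open>l ^ m * D\<close> is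
  uniform in the word and in both starting points.\<close>

lemma foldr_uniformly_close:
  assumes "e > 0"
  shows "\<exists>m. \<forall>w x y. m \<le> length w \<longrightarrow> dist (foldr g w x) (foldr g w y) < e"
proof -
  define D where "D = diameter (UNIV :: 'y set)"
  have D: "dist x y \<le> D" for x y :: 'y
    unfolding D_def by (rule diameter_bounded_bound) (auto intro: compact_imp_bounded compact_UNIV)
  have "(\<lambda>m. l ^ m * D) \<longlonglongrightarrow> 0"
    using l LIMSEQ_power_zero[of l] by (intro tendsto_mult_left_zero) auto
  then have "\<forall>\<^sub>F m in sequentially. l ^ m * D < e" using assms by (intro order_tendstoD(2))
  then obtain m where m: "\<And>k. k \<ge> m \<Longrightarrow> l ^ k * D < e"
    unfolding eventually_sequentially by blast
  have "dist (foldr g w x) (foldr g w y) < e" if "m \<le> length w" for w x y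
    using dist_foldr_le[of w x y] mult_left_mono[OF D[of x y], of "l ^ length w"] m[OF that] l
    by simp
  then show ?thesis by blast
qed

lemma continuous_foldr_uniformly_close:
  fixes \<phi> :: "'y \<Rightarrow> real"
  assumes "continuous_on UNIV \<phi>" "e > 0"
  shows "\<exists>m. \<forall>w x y. m \<le> length w \<longrightarrow> \<bar>\<phi> (foldr g w x) - \<phi> (foldr g w y)\<bar> < e"
proof -
  have "uniformly_continuous_on UNIV \<phi>"
    using assms(1) compact_UNIV by (rule compact_uniformly_continuous)
  then obtain d where d: "d > 0" "\<And>x y. dist x y < d \<Longrightarrow> dist (\<phi> x) (\<phi> y) < e"
    using assms(2) unfolding uniformly_continuous_on_def by (metis UNIV_I)
  from foldr_uniformly_close[OF d(1)] d(2) show ?thesis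
    unfolding dist_real_def by blast
qed

section \<open>Averaging over a random letter\<close>

definition letters :: "'i pmf" where "letters = embed_pmf p"

lemma pmf_letters: "pmf letters i = p i"
proof -
  have "(\<integral>\<^sup>+i. ennreal (p i) \<partial>count_space UNIV) = 1"
    using p by (simp add: nn_integral_count_space_finite sum_ennreal)
  then show ?thesis unfolding letters_def by (intro pmf_embed_pmf p(1))
qed

lemma measurable_letters_mixture:
  assumes h: "\<And>i. h i \<in> N \<rightarrow>\<^sub>M borel"
  shows "(\<lambda>(i, x). h i x) \<in> measure_pmf letters \<Otimes>\<^sub>M N \<rightarrow>\<^sub>M borel"
proof -
  have "(\<lambda>z. h (fst z) (snd z)) \<in> measure_pmf letters \<Otimes>\<^sub>M N \<rightarrow>\<^sub>M borel"
  proof (rule measurable_compose_countable)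
    show "(\<lambda>z. h i (snd z)) \<in> measure_pmf letters \<Otimes>\<^sub>M N \<rightarrow>\<^sub>M borel" for i
      by (rule measurable_compose[OF measurable_snd h])
    show "fst \<in> measure_pmf letters \<Otimes>\<^sub>M N \<rightarrow>\<^sub>M count_space UNIV"
      by (rule measurable_compose[OF measurable_fst]) simp
  qed
  then show ?thesis by (simp add: case_prod_unfold)
qed

text \<open>Fubini's theorem for a random letter and an independent point with law \<open>N\<close>.
  The cases needed are an invariant measure with the maps \<open>g i\<close>, and the Bernoulli
  measure with \<open>g i\<close> after \<open>code\<close>.\<close>

lemma integral_letters_mixture:
  fixes \<phi> :: "'y \<Rightarrow> real"
  assumes "prob_space N" and h: "\<And>i. h i \<in> N \<rightarrow>\<^sub>M borel"
    and \<phi>: "\<phi> \<in> borel_measurable borel" and bound: "\<And>y. \<bar>\<phi> y\<bar> \<le> B"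
  shows "(\<integral>y. \<phi> y \<partial>distr (measure_pmf letters \<Otimes>\<^sub>M N) borel (\<lambda>(i, x). h i x))
    = (\<Sum>i\<in>UNIV. p i * (\<integral>x. \<phi> (h i x) \<partial>N))"
proof -
  interpret N: prob_space N by fact
  interpret L: pair_prob_space "measure_pmf letters" N ..
  have "integrable (measure_pmf letters \<Otimes>\<^sub>M N) (\<lambda>z. \<phi> ((\<lambda>(i, x). h i x) z))"
    using bound measurable_compose[OF measurable_letters_mixture[OF h] \<phi>]
    by (intro L.P.integrable_const_bound[where B = B]) auto
  from L.integral_fst'[OF this]
  have "(\<integral>i. (\<integral>x. \<phi> (h i x) \<partial>N) \<partial>measure_pmf letters)
      = (\<integral>z. \<phi> ((\<lambda>(i, x). h i x) z) \<partial>(measure_pmf letters \<Otimes>\<^sub>M N))" by simp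
  also have "\<dots> = (\<integral>y. \<phi> y \<partial>distr (measure_pmf letters \<Otimes>\<^sub>M N) borel (\<lambda>(i, x). h i x))"
    by (rule integral_distr[OF measurable_letters_mixture[OF h] \<phi>, symmetric])
  finally show ?thesis
    by (simp add: integral_measure_pmf_real[where A = UNIV] pmf_letters mult.commute)
qed

lemma measure_letters_mixture:
  assumes N: "prob_space N" and h: "\<And>i. h i \<in> N \<rightarrow>\<^sub>M (borel :: 'y measure)" and B: "B \<in> sets borel"
  shows "measure (distr (measure_pmf letters \<Otimes>\<^sub>M N) borel (\<lambda>(i, x). h i x)) B
    = (\<Sum>i\<in>UNIV. p i * measure (distr N borel (h i)) B)"
proof -
  have "measure (distr N borel (h i)) B = (\<integral>x. indicat_real B (h i x) \<partial>N)" for i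
  proof -
    have "(\<integral>x. indicat_real B (h i x) \<partial>N) = (\<integral>y. indicat_real B y \<partial>distr N borel (h i))"
      using B by (intro integral_distr[symmetric] h) auto
    then show ?thesis using B by simp
  qed
  moreover have "measure (distr (measure_pmf letters \<Otimes>\<^sub>M N) borel (\<lambda>(i, x). h i x)) B
    = (\<integral>y. indicat_real B y \<partial>distr (measure_pmf letters \<Otimes>\<^sub>M N) borel (\<lambda>(i, x). h i x))"
    using B by simp
  ultimately show ?thesis
    using integral_letters_mixture[OF N h, of "indicat_real B" 1] B by simp
qed

section \<open>Invariant measures and their uniqueness\<close>

definition invariant :: "'y measure \<Rightarrow> bool" where
  "invariant \<mu> \<longleftrightarrow> prob_space \<mu> \<and> sets \<mu> = sets borel \<and>
    (\<forall>B\<in>sets borel. measure \<mu> B = (\<Sum>i\<in>UNIV. p i * measure (distr \<mu> borel (g i)) B))"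

lemma measurable_continuous:
  assumes "sets \<mu> = sets borel" "continuous_on UNIV (\<phi> :: 'y \<Rightarrow> real)"
  shows "\<phi> \<in> borel_measurable \<mu>"
  using borel_measurable_continuous_onI[OF assms(2)] measurable_cong_sets[OF assms(1) refl] by blast

lemma bounded_continuous:
  assumes "continuous_on UNIV (\<phi> :: 'y \<Rightarrow> real)"
  obtains B where "\<And>y. \<bar>\<phi> y\<bar> \<le> B"
  using compact_imp_bounded[OF compact_continuous_image[OF assms compact_UNIV]]
  unfolding bounded_iff by auto

lemma integrable_continuous:
  assumes "prob_space \<mu>" "sets \<mu> = sets borel" "continuous_on UNIV (\<phi> :: 'y \<Rightarrow> real)"
  shows "integrable \<mu> \<phi>"
proof -
  interpret prob_space \<mu> by fact
  obtain B where "\<And>y. \<bar>\<phi> y\<bar> \<le> B" using bounded_continuous[OF assms(3)] by blast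
  then show ?thesis
    using measurable_continuous[OF assms(2,3)] by (intro integrable_const_bound[where B = B]) auto
qed

text \<open>The setwise identity becomes an identity of measures, so that integrals can be unfolded
  as well.\<close>

lemma invariant_eq_mixture:
  assumes "invariant \<mu>"
  shows "\<mu> = distr (measure_pmf letters \<Otimes>\<^sub>M \<mu>) borel (\<lambda>(i, x). g i x)" (is "_ = ?\<nu>")
proof (rule measure_eqI)
  have \<mu>: "prob_space \<mu>" "sets \<mu> = sets borel" using assms by (auto simp: invariant_def)
  interpret \<mu>: prob_space \<mu> by fact
  interpret L: pair_prob_space "measure_pmf letters" \<mu> ..
  show "sets \<mu> = sets ?\<nu>" by (simp add: \<mu>)
  fix B assume "B \<in> sets \<mu>"
  then have B: "B \<in> sets borel" by (simp add: \<mu>)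
  have g: "g i \<in> \<mu> \<rightarrow>\<^sub>M borel" for i
    using measurable_g measurable_cong_sets[OF \<mu>(2) refl] by blast
  have "measure \<mu> B = measure ?\<nu> B"
    using measure_letters_mixture[OF \<mu>(1) g B] assms B by (simp add: invariant_def)
  moreover have "finite_measure ?\<nu>" by (rule L.P.finite_measure_distr[OF measurable_letters_mixture[OF g]])
  ultimately show "emeasure \<mu> B = emeasure ?\<nu> B"
    by (simp add: \<mu>.emeasure_eq_measure finite_measure.emeasure_eq_measure)
qed

text \<open>Iterated invariance: peeling off the outermost map replaces \<open>\<phi>\<close> by its
  composition with \<open>g c\<close>, which is why the induction varies
  \<open>\<phi>\<close>.\<close>

lemma invariant_integral_words:
  assumes \<mu>: "invariant \<mu>" and "continuous_on UNIV (\<phi> :: 'y \<Rightarrow> real)"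
  shows "(\<integral>y. \<phi> y \<partial>\<mu>) = (\<Sum>w\<in>words m. prod_list (map p w) * (\<integral>y. \<phi> (foldr g w y) \<partial>\<mu>))"
  using assms(2)
proof (induction m arbitrary: \<phi>)
  case (Suc m)
  have ps: "prob_space \<mu>" "sets \<mu> = sets borel" using \<mu> by (auto simp: invariant_def)
  have g: "g i \<in> \<mu> \<rightarrow>\<^sub>M borel" for i
    using measurable_g measurable_cong_sets[OF ps(2) refl] by blast
  obtain B where B: "\<And>y. \<bar>\<phi> y\<bar> \<le> B" using bounded_continuous[OF Suc.prems] by blast
  have "(\<integral>y. \<phi> y \<partial>\<mu>) = (\<integral>y. \<phi> y \<partial>distr (measure_pmf letters \<Otimes>\<^sub>M \<mu>) borel (\<lambda>(i, x). g i x))"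
    using invariant_eq_mixture[OF \<mu>] by simp
  also have "\<dots> = (\<Sum>c\<in>UNIV. p c * (\<integral>y. \<phi> (g c y) \<partial>\<mu>))"
    by (rule integral_letters_mixture[OF ps(1) g borel_measurable_continuous_onI[OF Suc.prems] B])
  also have "\<dots> = (\<Sum>c\<in>UNIV. p c * (\<Sum>w\<in>words m. prod_list (map p w) * (\<integral>y. \<phi> (g c (foldr g w y)) \<partial>\<mu>)))"
    by (intro sum.cong refl arg_cong2[where f = "(*)"] Suc.IH
        continuous_on_compose2[OF Suc.prems continuous_g]) auto
  finally show ?case
    by (simp add: sum_words_Suc sum_distrib_left mult.assoc)
qed (simp add: sum_words_0)

lemma sum_word_weights: "(\<Sum>w\<in>words m. prod_list (map p w)) = 1"
proof (induction m)
  case (Suc m)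
  have "(\<Sum>w\<in>words (Suc m). prod_list (map p w)) = (\<Sum>c\<in>UNIV. p c * (\<Sum>w\<in>words m. prod_list (map p w)))"
    by (simp add: sum_words_Suc sum_distrib_left)
  then show ?case using Suc p by simp
qed (simp add: sum_words_0)

text \<open>For words of length \<open>m\<close>, \<open>\<phi>\<close> after
  \<open>foldr g w\<close> is constant up to \<open>e\<close>, so its mean may be replaced by the
  value at \<open>y0\<close>; the word weights sum to 1, so the errors average to at most
  \<open>e\<close>.\<close>

lemma invariant_integral_approx:
  assumes \<mu>: "invariant \<mu>" and \<phi>: "continuous_on UNIV (\<phi> :: 'y \<Rightarrow> real)"
    and close: "\<And>w x y. m \<le> length w \<Longrightarrow> \<bar>\<phi> (foldr g w x) - \<phi> (foldr g w y)\<bar> < e"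
  shows "\<bar>(\<integral>y. \<phi> y \<partial>\<mu>) - (\<Sum>w\<in>words m. prod_list (map p w) * \<phi> (foldr g w y0))\<bar> \<le> e"
proof -
  have ps: "prob_space \<mu>" "sets \<mu> = sets borel" using \<mu> by (auto simp: invariant_def)
  interpret prob_space \<mu> by fact
  have cont: "continuous_on UNIV (\<lambda>y. \<phi> (foldr g w y))" for w
  proof -
    have "continuous_on UNIV (foldr g w)"
      by (induction w) (auto intro: continuous_on_compose2[OF continuous_g])
    then show ?thesis by (rule continuous_on_compose2[OF \<phi>]) auto
  qed
  have int: "integrable \<mu> (\<lambda>y. \<phi> (foldr g w y))" for w
    by (rule integrable_continuous[OF ps cont])
  have diff: "\<bar>(\<integral>y. \<phi> (foldr g w y) \<partial>\<mu>) - \<phi> (foldr g w y0)\<bar> \<le> e" if "w \<in> words m" for w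
  proof -
    have "(\<integral>y. \<phi> (foldr g w y) \<partial>\<mu>) - \<phi> (foldr g w y0) = (\<integral>y. \<phi> (foldr g w y) - \<phi> (foldr g w y0) \<partial>\<mu>)"
      using int by (simp add: prob_space)
    also have "\<bar>\<dots>\<bar> \<le> (\<integral>y. \<bar>\<phi> (foldr g w y) - \<phi> (foldr g w y0)\<bar> \<partial>\<mu>)"
      by (rule integral_abs_bound)
    also have "\<dots> \<le> (\<integral>y. e \<partial>\<mu>)"
      using close[of w] that int by (intro integral_mono) (auto simp: words_def intro: less_imp_le)
    finally show ?thesis by (simp add: prob_space)
  qed
  have nonneg: "0 \<le> prod_list (map p w)" for w using p by (induction w) auto
  have "(\<integral>y. \<phi> y \<partial>\<mu>) - (\<Sum>w\<in>words m. prod_list (map p w) * \<phi> (foldr g w y0))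
      = (\<Sum>w\<in>words m. prod_list (map p w) * ((\<integral>y. \<phi> (foldr g w y) \<partial>\<mu>) - \<phi> (foldr g w y0)))"
    by (simp add: invariant_integral_words[OF \<mu> \<phi>, of m] sum_subtractf right_diff_distrib)
  also have "\<bar>\<dots>\<bar> \<le> (\<Sum>w\<in>words m. prod_list (map p w) * e)"
    using diff nonneg by (intro order_trans[OF sum_abs] sum_mono) (auto simp: abs_mult intro: mult_left_mono)
  also have "\<dots> = e" by (simp add: sum_distrib_right[symmetric] sum_word_weights)
  finally show ?thesis .
qed

text \<open>The approximating sum over words does not involve the measure, so it lies within
  \<open>e / 2\<close> of both integrals; continuous functions then separate measures.\<close>

lemma invariant_unique:
  assumes "invariant \<mu>" "invariant \<nu>"
  shows "\<mu> = \<nu>"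
proof (rule measure_eqI_integral_continuous)
  fix \<phi> :: "'y \<Rightarrow> real" assume \<phi>: "continuous_on UNIV \<phi>"
  have "\<bar>(\<integral>y. \<phi> y \<partial>\<mu>) - (\<integral>y. \<phi> y \<partial>\<nu>)\<bar> \<le> 0 + e" if "e > 0" for e
  proof -
    have "e / 2 > 0" using that by simp
    then obtain m where m: "\<And>w x y. m \<le> length w \<Longrightarrow> \<bar>\<phi> (foldr g w x) - \<phi> (foldr g w y)\<bar> < e / 2"
      using continuous_foldr_uniformly_close[OF \<phi>] by blast
    have "\<bar>(\<integral>y. \<phi> y \<partial>\<rho>) - (\<Sum>w\<in>words m. prod_list (map p w) * \<phi> (foldr g w undefined))\<bar> \<le> e / 2"
      if "invariant \<rho>" for \<rho>
      using that by (intro invariant_integral_approx \<phi> m)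
    from this[OF assms(1)] this[OF assms(2)] show ?thesis by linarith
  qed
  then have "\<bar>(\<integral>y. \<phi> y \<partial>\<mu>) - (\<integral>y. \<phi> y \<partial>\<nu>)\<bar> \<le> 0" by (rule field_le_epsilon)
  then show "(\<integral>y. \<phi> y \<partial>\<mu>) = (\<integral>y. \<phi> y \<partial>\<nu>)" by simp
qed (use assms in \<open>auto simp: invariant_def\<close>)

text \<open>The invariant measure is the image of the Bernoulli measure under the coding map
  \<open>\<sigma> \<mapsto> lim (g\<^bsub>\<sigma> 0\<^esub> \<circ> \<dots> \<circ> g\<^bsub>\<sigma> n\<^esub>)\<close>.\<close>

definition code_approx :: "nat \<Rightarrow> (nat \<Rightarrow> 'i) \<Rightarrow> 'y" where
  "code_approx n \<sigma> = foldr g (map \<sigma> [0..<n]) undefined"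

definition code :: "(nat \<Rightarrow> 'i) \<Rightarrow> 'y" where
  "code \<sigma> = lim (\<lambda>n. code_approx n \<sigma>)"

text \<open>Approximations of index at least \<open>m\<close> share their \<open>m\<close> outermost
  maps, so they differ by less than \<open>e\<close>.\<close>

lemma code_approx_tendsto: "(\<lambda>n. code_approx n \<sigma>) \<longlonglongrightarrow> code \<sigma>"
proof -
  have "Cauchy (\<lambda>n. code_approx n \<sigma>)"
  proof (rule metric_CauchyI)
    fix e :: real assume "e > 0"
    from foldr_uniformly_close[OF this]
    obtain m where m: "\<And>w x y. m \<le> length w \<Longrightarrow> dist (foldr g w x) (foldr g w y) < e" by blast
    have tail: "\<exists>x. code_approx n \<sigma> = foldr g (map \<sigma> [0..<m]) x" if "n \<ge> m" for n
    proof -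
      have "[0..<n] = [0..<m] @ [m..<n]" using that by (metis le_add_diff_inverse upt_add_eq_append zero_le)
      then show ?thesis by (auto simp: code_approx_def)
    qed
    have "dist (code_approx j \<sigma>) (code_approx k \<sigma>) < e" if "j \<ge> m" "k \<ge> m" for j k
      using tail[OF that(1)] tail[OF that(2)] m[of "map \<sigma> [0..<m]"] by auto
    then show "\<exists>M. \<forall>j\<ge>M. \<forall>k\<ge>M. dist (code_approx j \<sigma>) (code_approx k \<sigma>) < e" by blast
  qed
  then have "convergent (\<lambda>n. code_approx n \<sigma>)"
    using compact_imp_complete[OF compact_UNIV] unfolding complete_def convergent_def by blast
  then show ?thesis unfolding code_def by (simp add: convergent_LIMSEQ_iff)
qed

text \<open>Continuity of \<open>g c\<close> lets it pass through the limit. This transports the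
  self-similarity of the Bernoulli measure to \<open>'y\<close>.\<close>

lemma code_case_nat: "code (case_nat c \<sigma>) = g c (code \<sigma>)"
proof (rule LIMSEQ_unique)
  have "code_approx (Suc n) (case_nat c \<sigma>) = g c (code_approx n \<sigma>)" for n
    by (simp add: code_approx_def map_upt_Suc del: upt_Suc)
  then show "(\<lambda>n. g c (code_approx n \<sigma>)) \<longlonglongrightarrow> code (case_nat c \<sigma>)"
    using LIMSEQ_Suc[OF code_approx_tendsto[of "case_nat c \<sigma>"]] by simp
  show "(\<lambda>n. g c (code_approx n \<sigma>)) \<longlonglongrightarrow> g c (code \<sigma>)"
    by (rule continuous_on_tendsto_compose[OF continuous_g code_approx_tendsto]) auto
qed

text \<open>Prepending an independent letter preserves the Bernoulli measure
  (\<open>PiM_iter\<close>); by \<open>code_case_nat\<close>, its image under \<open>code\<close> is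
  then invariant.\<close>

lemma ex_invariant: "\<exists>\<mu>. invariant \<mu>"
proof -
  let ?L = "measure_pmf letters"
  interpret sequence_space ?L by unfold_locales
  have letter: "(\<lambda>\<sigma>. \<sigma> i) \<in> S \<rightarrow>\<^sub>M count_space UNIV" for i
    using measurable_component_singleton[of i UNIV "\<lambda>_. ?L"] by simp
  have "(\<lambda>\<sigma>. foldr g (map \<sigma> is) undefined) \<in> S \<rightarrow>\<^sub>M borel" for "is"
  proof (induction "is")
    case (Cons i "is")
    have "(\<lambda>\<sigma>. g (\<sigma> i) (foldr g (map \<sigma> is) undefined)) \<in> S \<rightarrow>\<^sub>M borel"
      by (rule measurable_compose_countable[OF measurable_compose[OF Cons measurable_g] letter])
    then show ?case by simp
  qed simp
  then have code: "code \<in> S \<rightarrow>\<^sub>M borel"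
    by (intro borel_measurable_LIMSEQ_metric[OF _ code_approx_tendsto]) (simp add: code_approx_def)
  have "invariant (distr S borel code)"
    unfolding invariant_def
  proof (intro conjI ballI)
    show "prob_space (distr S borel code)" by (rule prob_space_distr[OF code])
    fix B :: "'y set" assume B: "B \<in> sets borel"
    have "distr S borel code = distr (distr (?L \<Otimes>\<^sub>M S) S (\<lambda>(c, \<sigma>). case_nat c \<sigma>)) borel code"
      by (simp only: PiM_iter)
    also have "\<dots> = distr (?L \<Otimes>\<^sub>M S) borel (code \<circ> (\<lambda>(c, \<sigma>). case_nat c \<sigma>))"
      by (rule distr_distr[OF code]) measurable
    also have "code \<circ> (\<lambda>(c, \<sigma>). case_nat c \<sigma>) = (\<lambda>(c, \<sigma>). g c (code \<sigma>))"
      by (auto simp: fun_eq_iff code_case_nat)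
    finally have eq: "distr S borel code = distr (?L \<Otimes>\<^sub>M S) borel (\<lambda>(c, \<sigma>). g c (code \<sigma>))" .
    have "measure (distr S borel code) B
        = (\<Sum>i\<in>UNIV. p i * measure (distr S borel (\<lambda>\<sigma>. g i (code \<sigma>))) B)"
      unfolding eq
      by (rule measure_letters_mixture[OF _ measurable_compose[OF code measurable_g] B]) unfold_locales
    then show "measure (distr S borel code) B
        = (\<Sum>i\<in>UNIV. p i * measure (distr (distr S borel code) borel (g i)) B)"
      by (simp add: distr_distr[OF measurable_g code] comp_def)
  qed simp
  then show ?thesis ..
qed

text \<open>Unique existence makes the definite description in \<open>measure_attractor\<close>
  meaningful.\<close>

lemma invariant_measure_attractor: "invariant (measure_attractor g p)"
proof -
  have "\<exists>!\<mu>. invariant \<mu>" using ex_invariant invariant_unique by blast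
  from theI'[OF this] show ?thesis unfolding measure_attractor_def invariant_def .
qed

text \<open>A deterministic statement: all randomness is confined to the frequency hypothesis, which
  does not mention \<open>\<phi>\<close>.\<close>

lemma average_along_typical_sequence:
  fixes \<phi> :: "'y \<Rightarrow> real"
  assumes \<mu>: "invariant \<mu>" and \<phi>: "continuous_on UNIV \<phi>"
    and freq: "\<And>w. (\<lambda>n. (\<Sum>k<n. of_bool (prefix w (history s k))) / real n)
      \<longlonglongrightarrow> prod_list (map p w)"
  shows "(\<lambda>n. (\<Sum>k<n. \<phi> (foldr g (history s k) x0)) / real n) \<longlonglongrightarrow> (\<integral>y. \<phi> y \<partial>\<mu>)"
proof (rule LIMSEQ_I)
  fix r :: real assume "r > 0"
  \<comment> \<open>Error budget: less than \<open>e\<close> for the averages of \<open>y\<close>,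
    less than \<open>2 * e\<close> for those of \<open>x - y\<close>, at most \<open>e\<close> for
    the integral.\<close>
  define e where "e = r / 4"
  have e: "e > 0" "r = 4 * e" using \<open>r > 0\<close> by (auto simp: e_def)
  obtain m where m: "\<And>w x y. m \<le> length w \<Longrightarrow> \<bar>\<phi> (foldr g w x) - \<phi> (foldr g w y)\<bar> < e"
    using continuous_foldr_uniformly_close[OF \<phi> e(1)] by blast
  define c where "c = (\<Sum>w\<in>words m. prod_list (map p w) * \<phi> (foldr g w x0))"
  define x where "x k = \<phi> (foldr g (history s k) x0)" for k
  \<comment> \<open>Of the words of length \<open>m\<close>, only the block of the \<open>m\<close>
    most recent letters is a prefix of the history, so one summand survives once
    \<open>k \<ge> m\<close>.\<close>
  define y where "y k = (\<Sum>w\<in>words m. of_bool (prefix w (history s k)) * \<phi> (foldr g w x0))" for k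
  have close: "\<bar>x k - y k\<bar> \<le> e" if "k \<ge> m" for k
  proof -
    let ?h = "history s k"
    have "y k = (\<Sum>w\<in>words m. if w = take m ?h then \<phi> (foldr g w x0) else 0)"
      unfolding y_def
    proof (intro sum.cong refl)
      fix w :: "'i list" assume "w \<in> words m"
      then have "length w = m" by (simp add: words_def)
      then have "prefix w ?h \<longleftrightarrow> w = take m ?h"
        by (metis append_eq_conv_conj prefix_def take_is_prefix)
      then show "of_bool (prefix w ?h) * \<phi> (foldr g w x0) = (if w = take m ?h then \<phi> (foldr g w x0) else 0)"
        by simp
    qed
    also have "\<dots> = \<phi> (foldr g (take m ?h) x0)"
    proof -
      have "length ?h = k" by (rule length_history)
      then have "take m ?h \<in> words m" using that by (simp add: words_def)
      then show ?thesis by (simp add: finite_words)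
    qed
    finally have y: "y k = \<phi> (foldr g (take m ?h) x0)" .
    \<comment> \<open>The older letters \<open>drop m ?h\<close> act first and merely change the
      starting point.\<close>
    have "foldr g ?h x0 = foldr g (take m ?h @ drop m ?h) x0" by simp
    then have "x k = \<phi> (foldr g (take m ?h) (foldr g (drop m ?h) x0))"
      unfolding x_def foldr_append by simp
    with y show ?thesis using m[of "take m ?h"] that by (simp add: less_imp_le)
  qed
  have "(\<lambda>n. (\<Sum>k<n. y k) / real n) \<longlonglongrightarrow> c"
  proof -
    have "(\<lambda>n. \<Sum>w\<in>words m. (\<Sum>k<n. of_bool (prefix w (history s k))) / real n * \<phi> (foldr g w x0)) \<longlonglongrightarrow> c"
      unfolding c_def by (intro tendsto_sum tendsto_mult freq tendsto_const)
    moreover have "(\<Sum>k<n. y k) / real n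
        = (\<Sum>w\<in>words m. (\<Sum>k<n. of_bool (prefix w (history s k))) / real n * \<phi> (foldr g w x0))" for n
      unfolding y_def by (subst sum.swap) (simp add: sum_divide_distrib sum_distrib_right)
    ultimately show ?thesis by simp
  qed
  from LIMSEQ_D[OF this e(1)]
  have avg_y: "\<forall>\<^sub>F n in sequentially. \<bar>(\<Sum>k<n. y k) / real n - c\<bar> < e"
    by (simp add: eventually_sequentially)
  have avg_xy: "\<forall>\<^sub>F n in sequentially. \<bar>(\<Sum>k<n. x k - y k) / real n\<bar> < 2 * e"
    using e by (intro eventually_average_less[OF close]) auto
  have "\<bar>(\<integral>y. \<phi> y \<partial>\<mu>) - c\<bar> \<le> e"
    unfolding c_def by (rule invariant_integral_approx[OF \<mu> \<phi> m])
  then have approx: "\<bar>c - (\<integral>y. \<phi> y \<partial>\<mu>)\<bar> \<le> e" by linarith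
  from avg_y avg_xy have "\<forall>\<^sub>F n in sequentially. \<bar>(\<Sum>k<n. x k) / real n - (\<integral>y. \<phi> y \<partial>\<mu>)\<bar> < r"
  proof eventually_elim
    case (elim n)
    then show ?case
      using approx unfolding sum_subtractf diff_divide_distrib e(2) by linarith
  qed
  then show "\<exists>N. \<forall>n\<ge>N. norm ((\<Sum>k<n. \<phi> (foldr g (history s k) x0)) / real n - (\<integral>y. \<phi> y \<partial>\<mu>)) < r"
    unfolding x_def by (simp add: eventually_sequentially)
qed

end

section \<open>Empirical measures and the superfractal chaos game\<close>

text \<open>As an image of the uniform distribution, the empirical measure becomes accessible to
  change of variables.\<close>

lemma empirical_measure_eq_distr:
  assumes "n > 0"
  shows "empirical_measure x n = distr (uniform_count_measure {1..n}) borel x"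
proof (rule measure_eqI)
  fix B assume "B \<in> sets (empirical_measure x n)"
  then have B: "B \<in> sets borel" by simp
  have "emeasure (distr (uniform_count_measure {1..n}) borel x) B
      = emeasure (uniform_count_measure {1..n}) (x -` B \<inter> {1..n})"
    using B by (subst emeasure_distr) (auto simp: space_uniform_count_measure)
  also have "\<dots> = ennreal (real (card (x -` B \<inter> {1..n})) / real n)"
    by (subst emeasure_uniform_count_measure) auto
  also have "\<dots> = of_nat (card (x -` B \<inter> {1..n})) / of_nat n"
    using assms by (simp add: divide_ennreal ennreal_of_nat_eq_real_of_nat)
  also have "of_nat (card (x -` B \<inter> {1..n})) = (\<Sum>k = 1..n. indicator B (x k) :: ennreal)"
    by (simp add: indicator_def sum.If_cases Int_def conj_commute vimage_def)
  finally show "emeasure (empirical_measure x n) B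
      = emeasure (distr (uniform_count_measure {1..n}) borel x) B"
    using B by (simp add: emeasure_empirical_measure)
qed simp

lemma integral_empirical_measure:
  fixes \<phi> :: "'y::topological_space \<Rightarrow> real"
  assumes "n > 0" "\<phi> \<in> borel_measurable borel"
  shows "(\<integral>y. \<phi> y \<partial>empirical_measure x n) = (\<Sum>k<n. \<phi> (x (Suc k))) / real n"
proof -
  have "(\<integral>y. \<phi> y \<partial>empirical_measure x n) = (\<integral>k. \<phi> (x k) \<partial>uniform_count_measure {1..n})"
    unfolding empirical_measure_eq_distr[OF assms(1)]
    by (intro integral_distr assms(2)) (auto simp: measurable_def space_uniform_count_measure)
  also have "\<dots> = (\<Sum>k = 1..n. \<phi> (x k)) / real n"
    by (simp add: integral_uniform_count_measure)
  finally show ?thesis by (simp add: sum.atLeast1_atMost_eq)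
qed

lemma entry_super_map_cong:
  "a v = b u \<Longrightarrow> entry (super_map f a K) v = entry (super_map f b K) u"
  by (simp add: super_map_def)

lemma measurable_entry: "(\<lambda>K. entry K v) \<in> borel \<rightarrow>\<^sub>M borel"
  by (rule borel_measurable_continuous_onI[OF continuous_on_entry])

theorem theorem16:
  fixes f :: "'n::finite \<Rightarrow> 'm::finite \<Rightarrow> 'x::metric_space \<Rightarrow> 'x"
    and l :: real
    and P :: "'n \<Rightarrow> real"
    and Pa :: "('n, 'm, 'v::finite) address \<Rightarrow> real"
    and one :: 'v
    and \<Omega> :: "'w measure"
    and a :: "nat \<Rightarrow> 'w \<Rightarrow> ('n, 'm, 'v) address"
    and K1 :: "('x hyperspace, 'v) tuple"
    and K :: "nat \<Rightarrow> 'w \<Rightarrow> ('x hyperspace, 'v) tuple"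
  assumes X_compact: "compact (UNIV :: 'x set)"
    and l: "0 \<le> l" "l < 1"
    and f_lipschitz: "\<And>n m. l-lipschitz_on UNIV (f n m)"
    and P: "\<And>n. 0 < P n" "(\<Sum>n\<in>UNIV. P n) = 1"
    and Pa: "\<And>c. 0 \<le> Pa c" "(\<Sum>c\<in>UNIV. Pa c) = 1"
  shows "(\<forall>v. component_set (super_set f :: ('x hyperspace, 'v) tuple set) v
            = component_set (super_set f) one)
    \<and> ((\<forall>c. Pa c = (\<Prod>v\<in>UNIV. P (fst (c v))) / real CARD('v) ^ (CARD('m) * CARD('v)))
       \<longrightarrow> prob_space \<Omega>
       \<longrightarrow> prob_space.indep_vars \<Omega> (\<lambda>_. count_space UNIV) a {1..}
       \<longrightarrow> (\<forall>k\<ge>1. \<forall>c. measure \<Omega> {\<omega> \<in> space \<Omega>. a k \<omega> = c} = Pa c)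
       \<longrightarrow> (\<forall>\<omega>. K 1 \<omega> = K1)
       \<longrightarrow> (\<forall>k\<ge>1. \<forall>\<omega>. K (Suc k) \<omega> = super_map f (a k \<omega>) (K k \<omega>))
       \<longrightarrow> (AE \<omega> in \<Omega>. \<forall>v. weakly_converges (empirical_measure (\<lambda>k. entry (K k \<omega>) v))
              (marginal (super_measure f Pa) one)))"
proof (intro conjI impI allI)
  interpret contractive_ifs "super_map f :: ('n, 'm, 'v) address \<Rightarrow> _" l Pa
    using compact_tuple[OF compact_hyperspace[OF X_compact]] l Pa
      lipschitz_on_super_map[OF l(1) f_lipschitz]
    by unfold_locales
  let ?A = "super_set f :: ('x hyperspace, 'v) tuple set"
  have fixed: "?A = (\<Union>c. super_map f c ` ?A)"
    unfolding super_set_def by (rule set_attractor_fixed)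
  have subset: "component_set ?A u \<subseteq> component_set ?A v" for u v
  proof
    fix k assume "k \<in> component_set ?A u"
    then obtain J where J: "J \<in> ?A" "k = entry J u" by (auto simp: component_set_def)
    from J(1) have "J \<in> (\<Union>c. super_map f c ` ?A)" by (rule subsetD[OF equalityD1[OF fixed]])
    then obtain c L where "L \<in> ?A" "J = super_map f c L" by (elim UN_E imageE)
    with J(2) have c: "L \<in> ?A" "k = entry (super_map f c L) u" by simp_all
    \<comment> \<open>A constant address makes all components of the image equal; with the row
      \<open>c u\<close> they all equal \<open>k\<close>.\<close>
    then have "k = entry (super_map f (\<lambda>_. c u) L) v" by (simp add: entry_super_map_cong[of c u "\<lambda>_. c u" v])
    moreover have "super_map f (\<lambda>_. c u) L \<in> ?A"
      by (rule subsetD[OF equalityD2[OF fixed]], rule UN_I[OF UNIV_I], rule imageI[OF c(1)])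
    ultimately show "k \<in> component_set ?A v" unfolding component_set_def by blast
  qed
  show "component_set ?A v = component_set ?A one" for v
    using subset by blast

  assume Pa_eq: "\<forall>c. Pa c = (\<Prod>v\<in>UNIV. P (fst (c v))) / real CARD('v) ^ (CARD('m) * CARD('v))"
    and \<Omega>: "prob_space \<Omega>"
    and indep: "prob_space.indep_vars \<Omega> (\<lambda>_. count_space UNIV) a {1..}"
    and distr_a: "\<forall>k\<ge>1. \<forall>c. measure \<Omega> {\<omega> \<in> space \<Omega>. a k \<omega> = c} = Pa c"
    and K1: "\<forall>\<omega>. K 1 \<omega> = K1"
    and K_Suc: "\<forall>k\<ge>1. \<forall>\<omega>. K (Suc k) \<omega> = super_map f (a k \<omega>) (K k \<omega>)"
  interpret iid_sequence \<Omega> a Pa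
    using \<Omega> indep distr_a by (auto simp: iid_sequence_def iid_sequence_axioms_def)
  let ?\<mu> = "super_measure f Pa :: ('x hyperspace, 'v) tuple measure"
  have \<mu>: "invariant ?\<mu>" unfolding super_measure_def by (rule invariant_measure_attractor)
  then interpret \<mu>: prob_space ?\<mu> by (simp add: invariant_def)
  have sets_\<mu>: "sets ?\<mu> = sets borel" using \<mu> by (simp add: invariant_def)
  have measurable_\<mu>: "h \<in> ?\<mu> \<rightarrow>\<^sub>M N" if "h \<in> borel \<rightarrow>\<^sub>M N" for h and N :: "'z measure"
    using that measurable_cong_sets[OF sets_\<mu> refl] by blast
  have measure_marginal: "measure (marginal ?\<mu> v) B
      = (\<Sum>c\<in>UNIV. Pa c * measure ?\<mu> {L. entry (super_map f c L) v \<in> B})"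
    if B: "B \<in> sets borel" for v B
  proof -
    have space: "space ?\<mu> = UNIV" using sets_eq_imp_space_eq[OF sets_\<mu>] by simp
    have entry_B: "{L :: ('x hyperspace, 'v) tuple. entry L v \<in> B} \<in> sets borel"
      using measurable_sets[OF measurable_entry B] by (simp add: vimage_def)
    have "measure (marginal ?\<mu> v) B = measure ?\<mu> {L. entry L v \<in> B}"
      unfolding marginal_def
      by (subst measure_distr[OF measurable_\<mu>[OF measurable_entry] B]) (simp add: space vimage_def)
    also have "\<dots> = (\<Sum>c\<in>UNIV. Pa c * measure (distr ?\<mu> borel (super_map f c)) {L. entry L v \<in> B})"
      using \<mu> entry_B unfolding invariant_def by blast
    also have "\<dots> = (\<Sum>c\<in>UNIV. Pa c * measure ?\<mu> {L. entry (super_map f c L) v \<in> B})"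
      by (intro sum.cong refl arg_cong2[where f = "(*)"],
          subst measure_distr[OF measurable_\<mu>[OF measurable_g] entry_B])
        (simp add: space vimage_def)
    finally show ?thesis .
  qed
  have marginal_eq: "marginal ?\<mu> v = marginal ?\<mu> one" for v
  proof (rule measure_eqI)
    \<comment> \<open>The transposition of \<open>v\<close> and \<open>one\<close>. Permuting the
      components of an address only permutes the factors of the product in
      \<open>Pa\<close>.\<close>
    define s where "s u = (if u = v then one else if u = one then v else u)" for u
    have ss: "s (s u) = u" for u by (simp add: s_def)
    have bij_s: "bij s" by (rule involuntory_imp_bij[OF ss])
    have bij_comp: "bij (\<lambda>c :: ('n, 'm, 'v) address. c \<circ> s)"
      by (rule involuntory_imp_bij) (simp add: fun_eq_iff ss)
    have Pa_comp: "Pa (c \<circ> s) = Pa c" for c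
      using prod.reindex_bij_betw[OF bij_s, of "\<lambda>u. P (fst (c u))"] Pa_eq by simp
    show "sets (marginal ?\<mu> v) = sets (marginal ?\<mu> one)" by (simp add: marginal_def)
    fix B assume "B \<in> sets (marginal ?\<mu> v)"
    then have B: "B \<in> sets borel" by (simp add: marginal_def)
    \<comment> \<open>Reindexed by \<open>c \<circ> s\<close>, component \<open>one\<close> reads
      the row \<open>c v\<close>.\<close>
    have "measure (marginal ?\<mu> one) B
        = (\<Sum>c\<in>UNIV. Pa (c \<circ> s) * measure ?\<mu> {L. entry (super_map f (c \<circ> s) L) one \<in> B})"
      unfolding measure_marginal[OF B] by (rule sum.reindex_bij_betw[OF bij_comp, symmetric])
    also have "\<dots> = measure (marginal ?\<mu> v) B"
      unfolding measure_marginal[OF B] Pa_comp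
      by (intro sum.cong refl arg_cong2[where f = "(*)"] arg_cong2[where f = measure] Collect_cong
          arg_cong2[where f = "(\<in>)"] entry_super_map_cong) (simp add: s_def)
    finally have "measure (marginal ?\<mu> v) B = measure (marginal ?\<mu> one) B" by simp
    moreover have "finite_measure (marginal ?\<mu> u)" for u
      unfolding marginal_def by (intro \<mu>.finite_measure_distr measurable_\<mu> measurable_entry)
    ultimately show "emeasure (marginal ?\<mu> v) B = emeasure (marginal ?\<mu> one) B"
      by (simp add: finite_measure.emeasure_eq_measure)
  qed
  \<comment> \<open>Off by one: \<open>K (Suc k)\<close> has used the letters 1 to \<open>k\<close>,
    and the most recent letter gives the outermost map.\<close>
  have K_history: "K (Suc k) \<omega> = foldr (super_map f) (history (\<lambda>i. a i \<omega>) k) K1" for k \<omega>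
    using K1 K_Suc by (induction k) auto
  \<comment> \<open>Words over a finite alphabet are countable, so one null set, fixed before
    \<open>v\<close> and \<open>\<phi>\<close>, serves for all.\<close>
  have "AE \<omega> in \<Omega>. \<forall>w. (\<lambda>n. (\<Sum>k<n. of_bool (prefix w (history (\<lambda>i. a i \<omega>) k))) / real n)
      \<longlonglongrightarrow> prod_list (map Pa w)"
    unfolding AE_all_countable using word_frequency by blast
  then show "AE \<omega> in \<Omega>. \<forall>v. weakly_converges (empirical_measure (\<lambda>k. entry (K k \<omega>) v))
      (marginal ?\<mu> one)"
  proof eventually_elim
    case (elim \<omega>)
    show ?case
      unfolding weakly_converges_def
    proof (intro allI impI)
      fix v and \<phi> :: "'x hyperspace \<Rightarrow> real"
      assume "continuous_on UNIV \<phi> \<and> bounded (range \<phi>)"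
      then have \<phi>: "continuous_on UNIV \<phi>" ..
      have cont: "continuous_on UNIV (\<lambda>L :: ('x hyperspace, 'v) tuple. \<phi> (entry L v))"
        by (rule continuous_on_compose2[OF \<phi> continuous_on_entry]) auto
      have integral_one: "(\<integral>y. \<phi> y \<partial>marginal ?\<mu> one) = (\<integral>L. \<phi> (entry L v) \<partial>?\<mu>)"
        unfolding marginal_eq[of v, symmetric] unfolding marginal_def
        by (rule integral_distr[OF measurable_\<mu>[OF measurable_entry] borel_measurable_continuous_onI[OF \<phi>]])
      have average: "(\<lambda>n. (\<Sum>k<n. \<phi> (entry (K (Suc k) \<omega>) v)) / real n) \<longlonglongrightarrow> (\<integral>L. \<phi> (entry L v) \<partial>?\<mu>)"
        unfolding K_history using elim by (intro average_along_typical_sequence[OF \<mu> cont]) blast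
      \<comment> \<open>The integral formula requires \<open>n > 0\<close>, which is enough for a
        limit.\<close>
      have empirical: "\<forall>\<^sub>F n in sequentially. (\<Sum>k<n. \<phi> (entry (K (Suc k) \<omega>) v)) / real n
          = (\<integral>y. \<phi> y \<partial>empirical_measure (\<lambda>k. entry (K k \<omega>) v) n)"
        using eventually_gt_at_top[of 0]
        by eventually_elim (simp add: integral_empirical_measure borel_measurable_continuous_onI[OF \<phi>])
      show "(\<lambda>n. \<integral>y. \<phi> y \<partial>empirical_measure (\<lambda>k. entry (K k \<omega>) v) n)
          \<longlonglongrightarrow> (\<integral>y. \<phi> y \<partial>marginal ?\<mu> one)"
        unfolding integral_one by (rule Lim_transform_eventually[OF average empirical])
    qed
  qed
qed

end
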